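(* Let $m\in\mathbb{R}$, $m\neq0$, and for $s=1,\dots,7$ let $S_s$ be a solvable Lie group with Lie algebra $\mathfrak{cp}_s^m$ (structure equations in the context, with respect to a basis $\{e^1,\dots,e^7\}$ of left-invariant $1$-forms). In each case the following family of left-invariant $\mathrm{G}_2$-structures $\varphi(t)$ on $S_s$ is a solution of the Laplacian LCP-coflow, i.e. $\psi(t)=\ast_t\varphi(t)$ satisfies $$\frac{d}{dt}\psi(t)=-\Delta_t\psi(t),\qquad \ast_t\psi(t)=\varphi(t)\ \text{locally conformal parallel for every }t.$$ $\mathfrak{cp}_1^m$: for $t\in(-\frac{1}{6m^2},\infty)$, $$\varphi(t)=(1+6m^2t)^{\frac{7}{6}}(e^{127}+e^{347}+e^{567})+(1+6m^2t)(e^{135}-e^{146}-e^{236}-e^{245}).$$ $\mathfrak{cp}_2^m$: for $t\in(-\frac{3}{16m^2},\infty)$, $$\varphi(t)=(1+\tfrac{16}{3}m^2t)^{\frac{17}{16}}(e^{127}-e^{236})+(1+\tfrac{16}{3}m^2t)^{\frac{19}{16}}(e^{347}+e^{567})+(1+\tfrac{16}{3}m^2t)^{\frac{15}{16}}(e^{135}-e^{146}-e^{245}).$$ $\mathfrak{cp}_3^m$: for $t\in(-\frac{1}{5m^2},\infty)$, $$\varphi(t)=(1+5m^2t)(e^{127}-e^{236}-e^{245})+(1+5m^2t)^{\frac{6}{5}}(e^{347}+e^{567})+(1+5m^2t)^{\frac{9}{10}}(e^{135}-e^{146}).$$ $\mathfrak{cp}_4^m$: for $t\in(-\frac{5}{24m^2},\infty)$,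 $$\varphi(t)=(1+\tfrac{24}{5}m^2t)^{\frac{23}{24}}(e^{127}-e^{146}-e^{236}-e^{245})+(1+\tfrac{24}{5}m^2t)^{\frac{29}{24}}(e^{347}+e^{567})+(1+\tfrac{24}{5}m^2t)^{\frac{7}{8}}e^{135}.$$ $\mathfrak{cp}_5^m$: for $t\in(-\frac{1}{5m^2},\infty)$, $$\varphi(t)=(1+5m^2t)(e^{127}-e^{146}-e^{245})+(1+5m^2t)^{\frac{6}{5}}(e^{347}+e^{567})+(1+5m^2t)^{\frac{9}{10}}(e^{135}-e^{236}).$$ $\mathfrak{cp}_6^m$: for $t\in(-\frac{3}{14m^2},\infty)$, $$\varphi(t)=(1+\tfrac{14}{3}m^2t)^{\frac{13}{14}}(e^{127}+e^{135}-e^{146}-e^{236}-e^{245})+(1+\tfrac{14}{3}m^2t)^{\frac{17}{14}}(e^{347}+e^{567}).$$ $\mathfrak{cp}_7^m$: for $t\in(-\frac{5}{24m^2},\infty)$, $$\varphi(t)=(1+\tfrac{24}{5}m^2t)^{\frac{9}{8}}(e^{127}+e^{347}+e^{567}-e^{236})+(1+\tfrac{24}{5}m^2t)^{\frac{7}{8}}(e^{135}-e^{146}-e^{245}).$$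
   Context: Notation: $e^{i_1\dots i_k}=e^{i_1}\wedge\dots\wedge e^{i_k}$. A Lie algebra is described by the tuple $(de^1,\dots,de^7)$ of exterior derivatives of a basis of its dual: \begin{align*} \mathfrak{cp}^m_1 &= (-me^{17}, -m e^{27}, -me^{37}, -m e^{47}, -me^{57}, -m e^{67}, 0);\\ \mathfrak{cp}^m_2 &= \big(-\tfrac43m e^{17}+\tfrac23me^{36}, -m e^{27}, -\tfrac23me^{37}, -m e^{47}, -me^{57}, -\tfrac23 m e^{67}, 0\big);\\ \mathfrak{cp}^m_3 &= \big(-\tfrac32m e^{17}+\tfrac12 m e^{36}+\tfrac12 m e^{45}, -m e^{27}, -\tfrac34me^{37}, -\tfrac34 m e^{47}, -\tfrac34me^{57}, -\tfrac34m e^{67}, 0\big);\\ \mathfrak{cp}^m_4 &= \big(-\tfrac75m e^{17}+\tfrac25 m e^{36}+\tfrac25 m e^{45}, -\tfrac65m e^{27}-\tfrac25m e^{46}, -\tfrac45me^{37}, -\tfrac35 m e^{47}, -\tfrac45me^{57},-\tfrac35m e^{67}, 0\big);\\ \mathfrak{cp}^m_5 &= \big(-\tfrac54 m e^{17}+\tfrac12 m e^{45}, -\tfrac54m e^{27}-\tfrac12m e^{46}, -me^{37}, -\tfrac12 m e^{47}, -\tfrac34me^{57}, -\tfrac34m e^{67}, 0\big);\\ \mathfrak{cp}^m_6 &= \big(-\tfrac43m e^{17}+\tfrac13 m e^{36}+\tfrac13 m e^{45}, -\tfrac43m e^{27}+\tfrac13m e^{35}-\tfrac13 m e^{46}, -\tfrac23me^{37},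 -\tfrac23 m e^{47}, -\tfrac23me^{57}, -\tfrac23m e^{67}, 0\big);\\ \mathfrak{cp}^m_7 &= \big(-\tfrac65m e^{17}+\tfrac25 m e^{36}, -\tfrac35m e^{27}, -\tfrac35me^{37}, \tfrac25 m e^{26}-\tfrac65 m e^{47}, \tfrac25 m e^{23}-\tfrac65me^{57}, -\tfrac35m e^{67}, 0\big). \end{align*} A $\mathrm{G}_2$-structure on a $7$-manifold is given by a $3$-form $\varphi$ which, with respect to some local basis of $1$-forms $\{x^1,\dots,x^7\}$ (an adapted basis), is $\varphi=x^{127}+x^{347}+x^{567}+x^{135}-x^{146}-x^{236}-x^{245}$. It induces the Riemannian metric $g_\varphi$ and the orientation for which $\{x^1,\dots,x^7\}$ is an oriented orthonormal coframe. $\Delta_t$ and $\ast_t$ denote the Hodge Laplacian $dd^{*}+d^{*}d$ and the Hodge star of the metric and orientation induced by $\varphi(t)$. A $\mathrm{G}_2$-structure $\varphi$ is locally conformal parallel (LCP, class $\mathcal{X}_4$) if there is a $1$-form $\tau$ (the Lee form) with $d\varphi=3\,\tau\wedge\varphi$ and $d{\ast}\varphi=4\,\tau\wedge{\ast}\varphi$. *)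

theory Defs
  imports "HOL-Analysis.Analysis" "HOL-Algebra.Solvable_Groups"
begin

section \<open>Smooth manifolds and Lie groups\<close>

text \<open>Class $C^k$ and $C^\infty$ on an \<^emph>\<open>open\<close> set \<open>S\<close>, by iterated directional derivatives.\<close>

primrec Ck_on :: "nat \<Rightarrow> 'a::euclidean_space set \<Rightarrow> ('a \<Rightarrow> 'b::real_normed_vector) \<Rightarrow> bool" where
  "Ck_on 0 S f \<longleftrightarrow> continuous_on S f"
| "Ck_on (Suc k) S f \<longleftrightarrow>
     f differentiable_on S \<and> (\<forall>b. Ck_on k S (\<lambda>x. frechet_derivative f (at x) b))"

definition smooth_on :: "'a::euclidean_space set \<Rightarrow> ('a \<Rightarrow> 'b::real_normed_vector) \<Rightarrow> bool" where
  "smooth_on S f \<longleftrightarrow> (\<forall>k. Ck_on k S f)"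

text \<open>A chart is a pair \<open>(U, \<kappa>)\<close>; the values of \<open>\<kappa>\<close> outside \<open>U\<close> are irrelevant.\<close>

type_synonym ('g, 'v) chart = "'g set \<times> ('g \<Rightarrow> 'v)"

definition chart_inv :: "('g, 'v) chart \<Rightarrow> 'v \<Rightarrow> 'g" where
  "chart_inv c = inv_into (fst c) (snd c)"

definition smooth_atlas :: "'g topology \<Rightarrow> ('g, 'v::euclidean_space) chart set \<Rightarrow> bool" where
  "smooth_atlas T A \<longleftrightarrow>
     (\<forall>c\<in>A. openin T (fst c) \<and> open (snd c ` fst c) \<and>
        homeomorphic_map (subtopology T (fst c)) (top_of_set (snd c ` fst c)) (snd c)) \<and>
     (\<Union>c\<in>A. fst c) = topspace T \<and>
     (\<forall>c\<in>A. \<forall>c'\<in>A. smooth_on (snd c ` (fst c \<inter> fst c')) (snd c' \<circ> chart_inv c))"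

definition smooth_manifold :: "'g topology \<Rightarrow> ('g, 'v::euclidean_space) chart set \<Rightarrow> bool" where
  "smooth_manifold T A \<longleftrightarrow> Hausdorff_space T \<and> second_countable T \<and> smooth_atlas T A"

definition smooth_map ::
  "'g topology \<Rightarrow> ('g, 'v::euclidean_space) chart set \<Rightarrow>
   'h topology \<Rightarrow> ('h, 'w::euclidean_space) chart set \<Rightarrow> ('g \<Rightarrow> 'h) \<Rightarrow> bool" where
  "smooth_map T A T' A' f \<longleftrightarrow> continuous_map T T' f \<and>
     (\<forall>c\<in>A. \<forall>c'\<in>A'. smooth_on (snd c ` (fst c \<inter> f -` fst c')) (snd c' \<circ> f \<circ> chart_inv c))"

definition prod_atlas ::
  "('g, 'v) chart set \<Rightarrow> ('h, 'w) chart set \<Rightarrow> ('g \<times> 'h, 'v \<times> 'w) chart set" where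
  "prod_atlas A B = {(fst a \<times> fst b, map_prod (snd a) (snd b)) | a b. a \<in> A \<and> b \<in> B}"

definition lie_group :: "'g monoid \<Rightarrow> 'g topology \<Rightarrow> ('g, 'v::euclidean_space) chart set \<Rightarrow> bool" where
  "lie_group G T A \<longleftrightarrow> group G \<and> topspace T = carrier G \<and> smooth_manifold T A \<and>
     smooth_map (prod_topology T T) (prod_atlas A A) T A (\<lambda>(a, b). a \<otimes>\<^bsub>G\<^esub> b) \<and>
     smooth_map T A T A (\<lambda>a. inv\<^bsub>G\<^esub> a)"

text \<open>The differential of \<open>f\<close> at \<open>p\<close>, read in the charts \<open>c\<close> around \<open>p\<close> and \<open>c'\<close> around \<open>f p\<close>.\<close>

definition chart_diff ::
  "('g, 'v::real_normed_vector) chart \<Rightarrow> ('h, 'w::real_normed_vector) chart \<Rightarrow>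
   ('g \<Rightarrow> 'h) \<Rightarrow> 'g \<Rightarrow> 'v \<Rightarrow> 'w" where
  "chart_diff c c' f p = frechet_derivative (snd c' \<circ> f \<circ> chart_inv c) (at (snd c p))"


section \<open>Exterior algebra of \<open>\<real>\<^sup>7\<close>\<close>

text \<open>A \<open>k\<close>-covector is evaluated on lists of vectors of length \<open>k\<close>; its values on lists of
  other lengths carry no meaning.\<close>

type_synonym vec = "real ^ 7"
type_synonym covector = "vec list \<Rightarrow> real"

definition is_covector :: "nat \<Rightarrow> covector \<Rightarrow> bool" where
  "is_covector k \<omega> \<longleftrightarrow> (\<forall>vs. length vs = k \<longrightarrow>
     (\<forall>i<k. linear (\<lambda>v. \<omega> (vs[i := v]))) \<and>
     (\<forall>i<k. \<forall>j<k. i \<noteq> j \<and> vs ! i = vs ! j \<longrightarrow> \<omega> vs = 0))"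

definition remove_nth :: "nat \<Rightarrow> 'a list \<Rightarrow> 'a list" where
  "remove_nth i xs = take i xs @ drop (Suc i) xs"

text \<open>Wedge product of a 1-covector with a \<open>k\<close>-covector, normalised so that
  $(\alpha^1\wedge\dots\wedge\alpha^k)(v_1,\dots,v_k)=\det(\alpha^i(v_j))$.\<close>

definition wedge1 :: "covector \<Rightarrow> covector \<Rightarrow> covector" where
  "wedge1 \<alpha> \<beta> = (\<lambda>vs. \<Sum>i<length vs. (-1) ^ i * \<alpha> [vs ! i] * \<beta> (remove_nth i vs))"

definition unit_covector :: covector where
  "unit_covector = (\<lambda>vs. if vs = [] then 1 else 0)"

text \<open>\<open>cov_mono x [i, \<dots>, j]\<close> is $x^{i\dots j}=x^i\wedge\dots\wedge x^j$; it vanishes on lists of the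
  wrong length.\<close>

definition cov_mono :: "(nat \<Rightarrow> covector) \<Rightarrow> nat list \<Rightarrow> covector" where
  "cov_mono x I = foldr (\<lambda>i. wedge1 (x i)) I unit_covector"

text \<open>A list of pairs \<open>(a, I)\<close> encodes the linear combination $\sum a\,x^I$.\<close>

type_synonym terms = "(real \<times> nat list) list"

definition lincomb :: "(nat \<Rightarrow> covector) \<Rightarrow> terms \<Rightarrow> covector" where
  "lincomb x ts = (\<lambda>vs. \<Sum>(a, I)\<leftarrow>ts. a * cov_mono x I vs)"

definition scale_terms :: "real \<Rightarrow> terms \<Rightarrow> terms" (infixr "\<cdot>\<^sub>t" 70) where
  "r \<cdot>\<^sub>t ts = map (\<lambda>(a, I). (r * a, I)) ts"

definition is_coframe :: "(nat \<Rightarrow> covector) \<Rightarrow> bool" where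
  "is_coframe x \<longleftrightarrow> (\<forall>i\<in>{1..7}. is_covector 1 (x i)) \<and>
     (\<forall>a. (\<forall>v. (\<Sum>i\<in>{1..7}. a i * x i [v]) = 0) \<longrightarrow> (\<forall>i\<in>{1..7}. a i = (0::real)))"

definition g2_terms :: terms where
  "g2_terms = [(1, [1,2,7]), (1, [3,4,7]), (1, [5,6,7]), (1, [1,3,5]),
               (-1, [1,4,6]), (-1, [2,3,6]), (-1, [2,4,5])]"

definition adapted :: "(nat \<Rightarrow> covector) \<Rightarrow> covector \<Rightarrow> bool" where
  "adapted x f \<longleftrightarrow> is_coframe x \<and> (\<forall>vs. length vs = 3 \<longrightarrow> f vs = lincomb x g2_terms vs)"

text \<open>Metric and volume form induced by a 3-covector: those for which an adapted coframe is
  orthonormal and positively oriented.\<close>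

definition g2_metric :: "covector \<Rightarrow> vec \<Rightarrow> vec \<Rightarrow> real" where
  "g2_metric f = (THE g. \<exists>x. adapted x f \<and> g = (\<lambda>u v. \<Sum>i\<in>{1..7}. x i [u] * x i [v]))"

definition g2_vol :: "covector \<Rightarrow> covector" where
  "g2_vol f = (THE vol. \<exists>x. adapted x f \<and> vol = cov_mono x [1,2,3,4,5,6,7])"

text \<open>Orthonormal frames are indexed by \<open>1, \<dots>, 7\<close>; being orthonormal forces them to be bases.\<close>

definition orthonormal_frame :: "(vec \<Rightarrow> vec \<Rightarrow> real) \<Rightarrow> (nat \<Rightarrow> vec) \<Rightarrow> bool" where
  "orthonormal_frame g E \<longleftrightarrow> (\<forall>i\<in>{1..7}. \<forall>j\<in>{1..7}. g (E i) (E j) = (if i = j then 1 else 0))"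

text \<open>Hodge star of a \<open>k\<close>-covector, $(\ast\omega)_{j\dots}=\frac1{k!}\,\omega^{i_1\dots i_k}\,
  \mathrm{vol}_{i_1\dots i_k j\dots}$, written in an orthonormal frame. The expression does not depend
  on the frame, and it satisfies $\alpha\wedge\ast\omega=\langle\alpha,\omega\rangle\,\mathrm{vol}$.\<close>

definition hodge :: "(vec \<Rightarrow> vec \<Rightarrow> real) \<Rightarrow> covector \<Rightarrow> nat \<Rightarrow> covector \<Rightarrow> covector" where
  "hodge g vol k \<omega> = (let E = (SOME E. orthonormal_frame g E) in
     (\<lambda>vs. (\<Sum>I\<in>{I. set I \<subseteq> {1..7} \<and> length I = k}. \<omega> (map E I) * vol (map E I @ vs)) / fact k))"


section \<open>Differential forms on 7-manifolds\<close>

text \<open>A form is given by its local representatives: \<open>\<omega> c p\<close> is the value at \<open>p\<close> read in the chart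
  \<open>c\<close>, meaningful for \<open>c\<close> in the atlas and \<open>p \<in> fst c\<close>. Accordingly, equality of forms is
  \<open>form_eq\<close>, not \<open>=\<close>.\<close>

type_synonym 'g form = "('g, vec) chart \<Rightarrow> 'g \<Rightarrow> covector"

definition form_eq :: "('g, vec) chart set \<Rightarrow> nat \<Rightarrow> 'g form \<Rightarrow> 'g form \<Rightarrow> bool" where
  "form_eq A k \<omega> \<eta> \<longleftrightarrow> (\<forall>c\<in>A. \<forall>p\<in>fst c. \<forall>vs. length vs = k \<longrightarrow> \<omega> c p vs = \<eta> c p vs)"

text \<open>Smooth \<open>k\<close>-forms on the open subset \<open>W\<close> of the manifold.\<close>

definition is_form :: "('g, vec) chart set \<Rightarrow> 'g set \<Rightarrow> nat \<Rightarrow> 'g form \<Rightarrow> bool" where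
  "is_form A W k \<omega> \<longleftrightarrow>
     (\<forall>c\<in>A. (\<forall>p \<in> fst c \<inter> W. is_covector k (\<omega> c p)) \<and>
        (\<forall>vs. length vs = k \<longrightarrow>
           smooth_on (snd c ` (fst c \<inter> W)) (\<lambda>x. \<omega> c (chart_inv c x) vs))) \<and>
     (\<forall>c\<in>A. \<forall>c'\<in>A. \<forall>p \<in> fst c \<inter> fst c' \<inter> W. \<forall>vs. length vs = k \<longrightarrow>
        \<omega> c p vs = \<omega> c' p (map (chart_diff c c' (\<lambda>q. q) p) vs))"

definition left_invariant :: "'g monoid \<Rightarrow> ('g, vec) chart set \<Rightarrow> nat \<Rightarrow> 'g form \<Rightarrow> bool" where
  "left_invariant G A k \<omega> \<longleftrightarrow>
     (\<forall>a\<in>carrier G. \<forall>c\<in>A. \<forall>c'\<in>A. \<forall>p\<in>fst c. a \<otimes>\<^bsub>G\<^esub> p \<in> fst c' \<longrightarrow>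
        (\<forall>vs. length vs = k \<longrightarrow>
           \<omega> c' (a \<otimes>\<^bsub>G\<^esub> p) (map (chart_diff c c' (\<lambda>q. a \<otimes>\<^bsub>G\<^esub> q) p) vs) = \<omega> c p vs))"

definition ext_d :: "'g form \<Rightarrow> 'g form" where
  "ext_d \<omega> = (\<lambda>c p vs. \<Sum>i<length vs. (-1) ^ i *
     frechet_derivative (\<lambda>x. \<omega> c (chart_inv c x) (remove_nth i vs)) (at (snd c p)) (vs ! i))"

definition form_wedge1 :: "'g form \<Rightarrow> 'g form \<Rightarrow> 'g form" where
  "form_wedge1 \<alpha> \<beta> = (\<lambda>c p. wedge1 (\<alpha> c p) (\<beta> c p))"

definition form_scale :: "real \<Rightarrow> 'g form \<Rightarrow> 'g form" where
  "form_scale r \<omega> = (\<lambda>c p vs. r * \<omega> c p vs)"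

definition form_add :: "'g form \<Rightarrow> 'g form \<Rightarrow> 'g form" where
  "form_add \<omega> \<eta> = (\<lambda>c p vs. \<omega> c p vs + \<eta> c p vs)"

definition form_lincomb :: "(nat \<Rightarrow> 'g form) \<Rightarrow> terms \<Rightarrow> 'g form" where
  "form_lincomb e ts = (\<lambda>c p. lincomb (\<lambda>i. e i c p) ts)"


section \<open>\<open>G\<^sub>2\<close>-structures\<close>

definition g2_structure :: "'g topology \<Rightarrow> ('g, vec) chart set \<Rightarrow> 'g form \<Rightarrow> bool" where
  "g2_structure T A \<phi> \<longleftrightarrow> is_form A (topspace T) 3 \<phi> \<and>
     (\<forall>q\<in>topspace T. \<exists>W x. openin T W \<and> q \<in> W \<and> (\<forall>i\<in>{1..7}. is_form A W 1 (x i)) \<and>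
        (\<forall>c\<in>A. \<forall>p \<in> fst c \<inter> W. adapted (\<lambda>i. x i c p) (\<phi> c p)))"

text \<open>In the following operators \<open>\<phi>\<close> is the \<open>G\<^sub>2\<close>-structure inducing metric and orientation, and
  \<open>k\<close> is the degree of the argument \<open>\<omega>\<close>. In dimension 7 one has $d^*=(-1)^k\ast d\,\ast$ on
  \<open>k\<close>-forms.\<close>

definition star :: "'g form \<Rightarrow> nat \<Rightarrow> 'g form \<Rightarrow> 'g form" where
  "star \<phi> k \<omega> = (\<lambda>c p. hodge (g2_metric (\<phi> c p)) (g2_vol (\<phi> c p)) k (\<omega> c p))"

definition codiff :: "'g form \<Rightarrow> nat \<Rightarrow> 'g form \<Rightarrow> 'g form" where
  "codiff \<phi> k \<omega> = form_scale ((-1) ^ k) (star \<phi> (8 - k) (ext_d (star \<phi> k \<omega>)))"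

definition laplacian :: "'g form \<Rightarrow> nat \<Rightarrow> 'g form \<Rightarrow> 'g form" where
  "laplacian \<phi> k \<omega> = form_add (ext_d (codiff \<phi> k \<omega>)) (codiff \<phi> (k + 1) (ext_d \<omega>))"

definition lcp :: "'g topology \<Rightarrow> ('g, vec) chart set \<Rightarrow> 'g form \<Rightarrow> bool" where
  "lcp T A \<phi> \<longleftrightarrow> g2_structure T A \<phi> \<and>
     (\<exists>\<tau>. is_form A (topspace T) 1 \<tau> \<and>
        form_eq A 4 (ext_d \<phi>) (form_scale 3 (form_wedge1 \<tau> \<phi>)) \<and>
        form_eq A 5 (ext_d (star \<phi> 3 \<phi>)) (form_scale 4 (form_wedge1 \<tau> (star \<phi> 3 \<phi>))))"

definition laplacian_lcp_coflow ::
  "'g topology \<Rightarrow> ('g, vec) chart set \<Rightarrow> real set \<Rightarrow> (real \<Rightarrow> 'g form) \<Rightarrow> bool" where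
  "laplacian_lcp_coflow T A J \<phi> \<longleftrightarrow> (let \<psi> = (\<lambda>t. star (\<phi> t) 3 (\<phi> t)) in
     \<forall>t\<in>J.
       (\<forall>c\<in>A. \<forall>p\<in>fst c. \<forall>vs. length vs = 4 \<longrightarrow>
          ((\<lambda>s. \<psi> s c p vs) has_real_derivative - laplacian (\<phi> t) 4 (\<psi> t) c p vs) (at t)) \<and>
       form_eq A 3 (star (\<phi> t) 4 (\<psi> t)) (\<phi> t) \<and>
       lcp T A (\<phi> t))"

definition invariant_coflow ::
  "'g monoid \<Rightarrow> 'g topology \<Rightarrow> ('g, vec) chart set \<Rightarrow> real set \<Rightarrow> (real \<Rightarrow> 'g form) \<Rightarrow> bool" where
  "invariant_coflow G T A J \<phi> \<longleftrightarrow>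
     (\<forall>t\<in>J. g2_structure T A (\<phi> t) \<and> left_invariant G A 3 (\<phi> t)) \<and>
     laplacian_lcp_coflow T A J \<phi>"


section \<open>Lie algebras given by structure equations\<close>

text \<open>\<open>e 1, \<dots>, e 7\<close> is a basis of left-invariant 1-forms whose exterior derivatives are the entries
  of the tuple \<open>des\<close>, expressed through the \<open>e i\<close>.\<close>

definition has_structure_equations ::
  "'g monoid \<Rightarrow> 'g topology \<Rightarrow> ('g, vec) chart set \<Rightarrow> (nat \<Rightarrow> 'g form) \<Rightarrow> terms list \<Rightarrow> bool" where
  "has_structure_equations G T A e des \<longleftrightarrow>
     (\<forall>i\<in>{1..7}. is_form A (topspace T) 1 (e i) \<and> left_invariant G A 1 (e i)) \<and>
     (\<forall>c\<in>A. \<forall>p\<in>fst c. is_coframe (\<lambda>i. e i c p)) \<and>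
     (\<forall>i\<in>{1..7}. form_eq A 2 (ext_d (e i)) (form_lincomb e (des ! (i - 1))))"

definition cp1 :: "real \<Rightarrow> terms list" where
  "cp1 m = [[(- m, [1,7])], [(- m, [2,7])], [(- m, [3,7])], [(- m, [4,7])],
            [(- m, [5,7])], [(- m, [6,7])], []]"

definition cp2 :: "real \<Rightarrow> terms list" where
  "cp2 m = [[(- (4/3) * m, [1,7]), (2/3 * m, [3,6])], [(- m, [2,7])], [(- (2/3) * m, [3,7])],
            [(- m, [4,7])], [(- m, [5,7])], [(- (2/3) * m, [6,7])], []]"

definition cp3 :: "real \<Rightarrow> terms list" where
  "cp3 m = [[(- (3/2) * m, [1,7]), (1/2 * m, [3,6]), (1/2 * m, [4,5])], [(- m, [2,7])],
            [(- (3/4) * m, [3,7])], [(- (3/4) * m, [4,7])], [(- (3/4) * m, [5,7])],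
            [(- (3/4) * m, [6,7])], []]"

definition cp4 :: "real \<Rightarrow> terms list" where
  "cp4 m = [[(- (7/5) * m, [1,7]), (2/5 * m, [3,6]), (2/5 * m, [4,5])],
            [(- (6/5) * m, [2,7]), (- (2/5) * m, [4,6])],
            [(- (4/5) * m, [3,7])], [(- (3/5) * m, [4,7])], [(- (4/5) * m, [5,7])],
            [(- (3/5) * m, [6,7])], []]"

definition cp5 :: "real \<Rightarrow> terms list" where
  "cp5 m = [[(- (5/4) * m, [1,7]), (1/2 * m, [4,5])],
            [(- (5/4) * m, [2,7]), (- (1/2) * m, [4,6])],
            [(- m, [3,7])], [(- (1/2) * m, [4,7])], [(- (3/4) * m, [5,7])],
            [(- (3/4) * m, [6,7])], []]"

definition cp6 :: "real \<Rightarrow> terms list" where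
  "cp6 m = [[(- (4/3) * m, [1,7]), (1/3 * m, [3,6]), (1/3 * m, [4,5])],
            [(- (4/3) * m, [2,7]), (1/3 * m, [3,5]), (- (1/3) * m, [4,6])],
            [(- (2/3) * m, [3,7])], [(- (2/3) * m, [4,7])], [(- (2/3) * m, [5,7])],
            [(- (2/3) * m, [6,7])], []]"

definition cp7 :: "real \<Rightarrow> terms list" where
  "cp7 m = [[(- (6/5) * m, [1,7]), (2/5 * m, [3,6])], [(- (3/5) * m, [2,7])],
            [(- (3/5) * m, [3,7])], [(2/5 * m, [2,6]), (- (6/5) * m, [4,7])],
            [(2/5 * m, [2,3]), (- (6/5) * m, [5,7])], [(- (3/5) * m, [6,7])], []]"

end

theory Submission
  imports Defs
begin

text \<open>Rescaling a left-invariant coframe by \<open>x\<^sup>i = s\<^bsup>r i\<^esup> e\<^sup>i\<close>, with weights \<open>r\<close> adapted to the Lie algebra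
  and \<open>r 7 = 1/2\<close>, only replaces the parameter \<open>m\<close> of the structure equations by \<open>m / \<surd>s\<close>. Each of
  the given families is the standard 3-form of such a coframe with \<open>s = 1 + \<kappa> m\<^sup>2 t\<close>. It is therefore
  enough to compute, for the standard 3-form in an adapted coframe, that \<open>m e\<^sup>7\<close> is a Lee form and that
  \<open>\<Delta>\<psi>\<close> multiplies the coefficient of each \<open>x\<^sup>I\<close> in \<open>\<psi>\<close> by a constant multiple of \<open>m\<^sup>2\<close>; the flow equation
  then says that this constant is \<open>- \<kappa> \<Sum>i\<in>I. r i\<close>. These are finite computations with formal linear
  combinations of monomials, whose sorted form decides equality.\<close>

section \<open>Exterior algebra on formal linear combinations\<close>

text \<open>The metric and volume form of a 3-form are given by \<open>THE\<close>, the frame in the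
  Hodge star by \<open>SOME\<close>. Nothing can be computed until the 3-form is known to determine
  its metric and volume, and the star to be independent of the frame. After that, the star of a
  monomial is a contraction of the volume form. The formal identities hold for an arbitrary family
  \<open>y\<close> of covectors, because sorting uses only that 1-covectors anticommute; no chart,
  point or linear independence enters. The weights are not guessed. The seven index triples of phi
  are the lines of the Fano plane, whose incidence matrix is invertible, so the exponents prescribed
  for the monomials of phi determine \<open>r 1\<close>, ..., \<open>r 7\<close>: if S is the sum of
  the weights, the exponents of the three monomials that contain i add up to S + 2 r i, and all
  seven exponents add up to 3 S.\<close>

definition altsum :: "('a \<Rightarrow> 'a list \<Rightarrow> real) \<Rightarrow> 'a list \<Rightarrow> real" where
  "altsum h vs = (\<Sum>i<length vs. (-1) ^ i * h (vs ! i) (remove_nth i vs))"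

lemma altsum_Nil [simp]: "altsum h [] = 0"
  by (simp add: altsum_def)

text \<open>This recursion trades positions and signs for list structure. \<open>wedge1\<close>,
  \<open>ext_d\<close> and sums over index lists are all treated through it.\<close>

lemma altsum_Cons [simp]: "altsum h (v # vs) = h v vs - altsum (\<lambda>u us. h u (v # us)) vs"
  by (simp add: altsum_def sum.lessThan_Suc_shift remove_nth_def sum_negf [symmetric] del: sum.lessThan_Suc)

lemma altsum_zero [simp]: "altsum (\<lambda>u us. 0) vs = 0"
  by (simp add: altsum_def)

lemma altsum_add: "altsum (\<lambda>u us. h u us + k u us) vs = altsum h vs + altsum k vs"
  by (simp add: altsum_def sum.distrib algebra_simps)

lemma altsum_mult: "altsum (\<lambda>u us. a * h u us) vs = a * altsum h vs"
  by (simp add: altsum_def sum_distrib_left algebra_simps)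

lemma altsum_minus: "altsum (\<lambda>u us. - h u us) vs = - altsum h vs"
  using altsum_mult [of "-1"] by simp

lemma altsum_diff: "altsum (\<lambda>u us. h u us - k u us) vs = altsum h vs - altsum k vs"
  using altsum_add [of h "\<lambda>u us. - k u us"] by (simp add: altsum_minus)

lemmas altsum_fun = altsum_zero [THEN ext] altsum_add [THEN ext] altsum_diff [THEN ext]
  altsum_mult [THEN ext]

lemma altsum_map: "altsum h (map f vs) = altsum (\<lambda>u us. h (f u) (map f us)) vs"
  by (induction vs arbitrary: h) simp_all

lemma altsum_cong:
  assumes "\<And>u us. Suc (length us) = length vs \<Longrightarrow> h u us = k u us"
  shows "altsum h vs = altsum k vs"
  unfolding altsum_def
proof (rule sum.cong [OF refl])
  fix i assume "i \<in> {..<length vs}"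
  then have "h (vs ! i) (remove_nth i vs) = k (vs ! i) (remove_nth i vs)"
    by (intro assms) (auto simp: remove_nth_def)
  then show "(-1) ^ i * h (vs ! i) (remove_nth i vs) = (-1) ^ i * k (vs ! i) (remove_nth i vs)"
    by simp
qed

text \<open>Removing one entry shifts the later ones by one place, so removing two entries in the
  other order costs a sign. Anticommutation of 1-covectors and the sign in the Leibniz rule both
  come from here.\<close>

lemma altsum_swap:
  "altsum (\<lambda>u. altsum (\<lambda>w. h w u)) vs = - altsum (\<lambda>u. altsum (\<lambda>w. h u w)) vs"
proof (induction vs arbitrary: h)
  case (Cons v vs)
  show ?case
    using Cons [of "\<lambda>u w us. h u w (v # us)"] by (simp add: altsum_diff)
qed simp

lemma wedge1_altsum: "wedge1 \<alpha> \<beta> = altsum (\<lambda>u us. \<alpha> [u] * \<beta> us)"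
  by (simp add: wedge1_def altsum_def fun_eq_iff mult.assoc)

lemma wedge1_Nil [simp]: "wedge1 \<alpha> \<beta> [] = 0"
  by (simp add: wedge1_altsum)

lemma wedge1_Cons:
  "wedge1 \<alpha> \<beta> (v # vs) = \<alpha> [v] * \<beta> vs - wedge1 \<alpha> (\<lambda>us. \<beta> (v # us)) vs"
  by (simp add: wedge1_altsum)

lemma wedge1_zero [simp]: "wedge1 \<alpha> (\<lambda>us. 0) vs = 0"
  by (simp add: wedge1_altsum)

lemma wedge1_mult: "wedge1 \<alpha> (\<lambda>us. a * \<beta> us) vs = a * wedge1 \<alpha> \<beta> vs"
  using altsum_mult [of a "\<lambda>u us. \<alpha> [u] * \<beta> us"] by (simp add: wedge1_altsum mult.left_commute)

lemma wedge1_add: "wedge1 \<alpha> (\<lambda>us. \<beta> us + \<gamma> us) vs = wedge1 \<alpha> \<beta> vs + wedge1 \<alpha> \<gamma> vs"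
  by (simp add: wedge1_altsum ring_distribs altsum_add)

lemma wedge1_sum_list:
  "wedge1 \<alpha> (\<lambda>us. \<Sum>z\<leftarrow>zs. \<beta> z us) vs = (\<Sum>z\<leftarrow>zs. wedge1 \<alpha> (\<beta> z) vs)"
  by (induction zs) (simp_all add: wedge1_add)

text \<open>The bilinear form need not be antisymmetric: in the computation of the exterior
  derivative it is the plain matrix of partial derivatives of a 1-form.\<close>

definition wedge2 :: "(vec \<Rightarrow> vec \<Rightarrow> real) \<Rightarrow> covector \<Rightarrow> covector" where
  "wedge2 \<omega> \<beta> = altsum (\<lambda>u. altsum (\<lambda>w us. \<omega> u w * \<beta> us))"

lemma wedge2_swap: "wedge2 (\<lambda>u w. \<omega> w u) \<beta> vs = - wedge2 \<omega> \<beta> vs"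
  unfolding wedge2_def by (rule altsum_swap)

lemma wedge2_add: "wedge2 (\<lambda>u w. \<omega> u w + \<eta> u w) \<beta> vs = wedge2 \<omega> \<beta> vs + wedge2 \<eta> \<beta> vs"
  by (simp add: wedge2_def ring_distribs altsum_fun)

lemma wedge2_diff: "wedge2 (\<lambda>u w. \<omega> u w - \<eta> u w) \<beta> vs = wedge2 \<omega> \<beta> vs - wedge2 \<eta> \<beta> vs"
  by (simp add: wedge2_def ring_distribs altsum_fun)

lemma wedge2_mult: "wedge2 (\<lambda>u w. a * \<omega> u w) \<beta> vs = a * wedge2 \<omega> \<beta> vs"
  by (simp add: wedge2_def altsum_fun mult.assoc)

lemma wedge2_decomposable: "wedge2 (\<lambda>u w. \<alpha> [u] * \<gamma> [w]) \<beta> = wedge1 \<alpha> (wedge1 \<gamma> \<beta>)"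
  by (simp add: wedge2_def wedge1_altsum altsum_fun mult.assoc)

text \<open>Only the antisymmetric part contributes; for the derivative matrix of a 1-form that part
  is its exterior derivative.\<close>

lemma wedge2_antisym:
  "2 * wedge2 \<omega> \<beta> vs = wedge2 (\<lambda>u w. \<omega> u w - \<omega> w u) \<beta> vs"
  by (simp add: wedge2_diff wedge2_swap [of \<omega>])

lemma wedge1_anticommute: "wedge1 \<alpha> (wedge1 \<gamma> \<beta>) vs = - wedge1 \<gamma> (wedge1 \<alpha> \<beta>) vs"
proof -
  have "wedge1 \<alpha> (wedge1 \<gamma> \<beta>) vs = wedge2 (\<lambda>u w. \<gamma> [w] * \<alpha> [u]) \<beta> vs"
    by (simp add: wedge2_decomposable [symmetric] mult.commute)
  then show ?thesis
    using wedge2_swap [of "\<lambda>u w. \<gamma> [u] * \<alpha> [w]"] by (simp add: wedge2_decomposable)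
qed

section \<open>Monomials in a coframe and their linear combinations\<close>

lemma cov_mono_Nil [simp]: "cov_mono x [] = unit_covector"
  by (simp add: cov_mono_def)

lemma cov_mono_Cons [simp]: "cov_mono x (i # I) = wedge1 (x i) (cov_mono x I)"
  by (simp add: cov_mono_def)

lemma cov_mono_length: "length vs \<noteq> length I \<Longrightarrow> cov_mono x I vs = 0"
proof (induction I arbitrary: vs)
  case (Cons i I)
  have "cov_mono x (i # I) vs = altsum (\<lambda>u us. 0) vs"
    unfolding cov_mono_Cons wedge1_altsum
    by (rule altsum_cong) (use Cons in auto)
  then show ?case by simp
qed (simp add: unit_covector_def)

text \<open>Pull-back along \<open>D\<close>. With \<open>D\<close> a chart differential, the
  differential of a left translation or a homothety, it reduces statements on monomials to
  statements on 1-covectors.\<close>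

lemma cov_mono_map:
  assumes "\<And>i v. i \<in> set I \<Longrightarrow> x i [D v] = y i [v]"
  shows "cov_mono x I (map D vs) = cov_mono y I vs"
  using assms
proof (induction I arbitrary: vs)
  case (Cons i I)
  then show ?case by (simp add: wedge1_altsum altsum_map)
qed (simp add: unit_covector_def)

lemma cov_mono_scale:
  "cov_mono (\<lambda>i vs. c i * x i vs) I vs = prod_list (map c I) * cov_mono x I vs"
proof (induction I arbitrary: vs)
  case (Cons i I)
  have "cov_mono (\<lambda>i vs. c i * x i vs) (i # I) vs
      = altsum (\<lambda>u us. c i * prod_list (map c I) * (x i [u] * cov_mono x I us)) vs"
    by (simp add: wedge1_altsum Cons ac_simps)
  also have "\<dots> = prod_list (map c (i # I)) * cov_mono x (i # I) vs"
    unfolding altsum_mult by (simp add: wedge1_altsum)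
  finally show ?case .
qed simp

lemma lincomb_Nil [simp]: "lincomb x [] vs = 0"
  by (simp add: lincomb_def)

lemma lincomb_Cons: "lincomb x ((a, I) # ts) vs = a * cov_mono x I vs + lincomb x ts vs"
  by (simp add: lincomb_def)

lemma lincomb_append: "lincomb x (ts @ us) vs = lincomb x ts vs + lincomb x us vs"
  by (simp add: lincomb_def)

lemma lincomb_scale: "lincomb x (r \<cdot>\<^sub>t ts) vs = r * lincomb x ts vs"
  by (induction ts) (auto simp: scale_terms_def lincomb_Cons algebra_simps)

lemma lincomb_map:
  assumes "\<And>a I i v. (a, I) \<in> set ts \<Longrightarrow> i \<in> set I \<Longrightarrow> x i [D v] = y i [v]"
  shows "lincomb x ts (map D vs) = lincomb y ts vs"
  using assms
proof (induction ts)
  case (Cons t ts)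
  obtain a I where t: "t = (a, I)" by force
  have "cov_mono x I (map D vs) = cov_mono y I vs"
    by (rule cov_mono_map, rule Cons.prems) (auto simp: t)
  moreover have "lincomb x ts (map D vs) = lincomb y ts vs" by (rule Cons.IH) (use Cons.prems in auto)
  ultimately show ?case by (simp add: t lincomb_Cons)
qed simp

text \<open>The sign counts the transpositions. A repeated index gives coefficient 0, and the list
  returned with it carries no meaning.\<close>

fun insert_sorted :: "nat \<Rightarrow> nat list \<Rightarrow> real \<times> nat list" where
  "insert_sorted i [] = (1, [i])"
| "insert_sorted i (j # J) =
     (if i < j then (1, i # j # J) else if i = j then (0, [])
      else case insert_sorted i J of (s, K) \<Rightarrow> (- s, j # K))"

lemma insert_sorted: "insert_sorted i J = (s, K) \<Longrightarrow> cov_mono x (i # J) vs = s * cov_mono x K vs"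
proof (induction J arbitrary: s K vs)
  case (Cons j J)
  show ?case
  proof (cases "i < j")
    case False
    show ?thesis
    proof (cases "i = j")
      case True
      then show ?thesis using Cons.prems wedge1_anticommute [of "x i" "x i"] by simp
    next
      case ne: False
      obtain s' K' where sK: "insert_sorted i J = (s', K')" by force
      with Cons.prems False ne have "s = - s'" "K = j # K'" by auto
      moreover have "wedge1 (x i) (cov_mono x J) = (\<lambda>us. s' * cov_mono x K' us)"
        using Cons.IH [OF sK] by (simp add: fun_eq_iff)
      ultimately show ?thesis
        using wedge1_anticommute [of "x i" "x j" "cov_mono x J"] by (simp add: wedge1_mult)
    qed
  qed (use Cons.prems in simp)
qed simp

fun sort_mono :: "nat list \<Rightarrow> real \<times> nat list" where
  "sort_mono [] = (1, [])"
| "sort_mono (i # I) = (case sort_mono I of (s, J) \<Rightarrow>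
     case insert_sorted i J of (s', K) \<Rightarrow> (s * s', K))"

lemma sort_mono: "sort_mono I = (s, J) \<Longrightarrow> cov_mono x I vs = s * cov_mono x J vs"
proof (induction I arbitrary: s J vs)
  case (Cons i I)
  obtain s' J' where s': "sort_mono I = (s', J')" by force
  obtain s'' K where s'': "insert_sorted i J' = (s'', K)" by force
  have eq: "cov_mono x I = (\<lambda>us. s' * cov_mono x J' us)"
    using Cons.IH [OF s'] by (simp add: fun_eq_iff)
  have "cov_mono x (i # I) vs = s' * cov_mono x (i # J') vs"
    by (simp add: eq wedge1_mult)
  then show ?case
    using insert_sorted [OF s'', of x vs] Cons.prems s' s'' by auto
qed auto

text \<open>Equal index lists are not merged. Once sorted, the values \<open>cov_mono x J vs\<close>
  serve as atoms, and comparing two combinations is ring arithmetic left to the simplifier.\<close>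

definition sort_terms :: "terms \<Rightarrow> terms" where
  "sort_terms ts = map (\<lambda>(a, I). case sort_mono I of (s, J) \<Rightarrow> (a * s, J)) ts"

lemma lincomb_sort: "lincomb x (sort_terms ts) = lincomb x ts"
proof
  show "lincomb x (sort_terms ts) vs = lincomb x ts vs" for vs
  proof (induction ts)
    case (Cons t ts)
    obtain a I where t: "t = (a, I)" by force
    obtain s J where s: "sort_mono I = (s, J)" by force
    show ?case using Cons sort_mono [OF s, of x vs] by (simp add: sort_terms_def t s lincomb_Cons)
  qed (simp add: sort_terms_def)
qed

text \<open>Interior product of a monomial with a vector v, of which only the numbers
  \<open>c i\<close>, the values of \<open>x i\<close> on v, enter.\<close>

primrec contract_mono :: "(nat \<Rightarrow> real) \<Rightarrow> nat list \<Rightarrow> terms" where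
  "contract_mono c [] = []"
| "contract_mono c (i # I) = (c i, I) # map (\<lambda>(a, J). (- a, i # J)) (contract_mono c I)"

lemma lincomb_Cons_index:
  "lincomb x (map (\<lambda>(a, J). (r * a, i # J)) ts) vs = r * wedge1 (x i) (lincomb x ts) vs"
proof -
  have "lincomb x (map (\<lambda>(a, J). (r * a, i # J)) ts) vs
      = (\<Sum>(a, J)\<leftarrow>ts. r * wedge1 (x i) (\<lambda>us. a * cov_mono x J us) vs)"
    by (simp add: lincomb_def wedge1_mult o_def split_def mult.assoc)
  also have "\<dots> = r * wedge1 (x i) (lincomb x ts) vs"
    using wedge1_sum_list [of "x i" "\<lambda>(a, J) us. a * cov_mono x J us" ts vs]
    by (simp add: lincomb_def sum_list_const_mult split_def)
  finally show ?thesis .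
qed

lemma lincomb_contract_mono:
  "lincomb x (contract_mono (\<lambda>i. x i [v]) I) vs = cov_mono x I (v # vs)"
proof (induction I arbitrary: vs)
  case (Cons i I)
  show ?case
    using lincomb_Cons_index [of x "-1" i "contract_mono (\<lambda>i. x i [v]) I" vs]
    by (simp add: lincomb_Cons wedge1_Cons Cons [THEN ext])
qed (simp add: unit_covector_def)

definition contract_terms :: "(nat \<Rightarrow> real) \<Rightarrow> terms \<Rightarrow> terms" where
  "contract_terms c ts = concat (map (\<lambda>(a, I). a \<cdot>\<^sub>t contract_mono c I) ts)"

lemma lincomb_contract: "lincomb x (contract_terms (\<lambda>i. x i [v]) ts) vs = lincomb x ts (v # vs)"
  by (induction ts)
    (auto simp: contract_terms_def lincomb_append lincomb_scale lincomb_Cons lincomb_contract_mono)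

definition wedge_terms :: "terms \<Rightarrow> terms \<Rightarrow> terms" where
  "wedge_terms ts us = concat (map (\<lambda>(a, I). map (\<lambda>(b, J). (a * b, I @ J)) us) ts)"

text \<open>A monomial of degree 2 is the difference of two tensor products with exchanged
  arguments; by \<open>wedge2_swap\<close> both contribute the same, whence the factor 2.\<close>

lemma wedge2_lincomb:
  assumes "\<And>a I. (a, I) \<in> set ts \<Longrightarrow> length I = 2"
  shows "wedge2 (\<lambda>u w. lincomb x ts [u, w]) (lincomb x us) vs = 2 * lincomb x (wedge_terms ts us) vs"
  using assms
proof (induction ts)
  case (Cons t ts)
  obtain a I where t: "t = (a, I)" by force
  moreover have "length I = 2" using Cons.prems t by auto
  ultimately obtain i j where t: "t = (a, [i, j])"
    by (auto simp: length_Suc_conv numeral_2_eq_2)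
  have *: "lincomb x (map (\<lambda>(b, J). (a * b, i # j # J)) us) vs
      = a * wedge1 (x i) (wedge1 (x j) (lincomb x us)) vs"
  proof -
    have "lincomb x (map (\<lambda>(b, J). (b, j # J)) us) = wedge1 (x j) (lincomb x us)"
      using lincomb_Cons_index [of x 1 j us] by (simp add: fun_eq_iff)
    then show ?thesis
      using lincomb_Cons_index [of x a i "map (\<lambda>(b, J). (b, j # J)) us" vs]
      by (simp add: o_def split_def)
  qed
  have "wedge2 (\<lambda>u w. lincomb x [(a, [i, j])] [u, w]) (lincomb x us) vs
      = wedge2 (\<lambda>u w. a * (x i [u] * x j [w]) - a * (x i [w] * x j [u])) (lincomb x us) vs"
    by (simp add: lincomb_Cons wedge1_Cons unit_covector_def algebra_simps)
  also have "\<dots> = 2 * (a * wedge1 (x i) (wedge1 (x j) (lincomb x us)) vs)"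
    using wedge2_swap [of "\<lambda>u w. x i [u] * x j [w]" "lincomb x us" vs]
    by (simp add: wedge2_diff wedge2_mult wedge2_decomposable)
  finally have **: "wedge2 (\<lambda>u w. a * cov_mono x [i, j] [u, w]) (lincomb x us) vs
      = 2 * (a * wedge1 (x i) (wedge1 (x j) (lincomb x us)) vs)"
    by (simp add: lincomb_Cons)
  have "wedge2 (\<lambda>u w. lincomb x ts [u, w]) (lincomb x us) vs = 2 * lincomb x (wedge_terms ts us) vs"
    by (rule Cons.IH) (use Cons.prems in auto)
  then show ?case
    using * ** by (simp add: t wedge_terms_def lincomb_append lincomb_Cons wedge2_add del: cov_mono_Cons)
qed (simp add: wedge_terms_def wedge2_def altsum_fun)

section \<open>Hodge star in a coframe\<close>

lemma sum_lists_Suc: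
  assumes "finite S"
  shows "(\<Sum>I\<in>{I. set I \<subseteq> S \<and> length I = Suc k}. h I)
    = (\<Sum>i\<in>S. \<Sum>I\<in>{I. set I \<subseteq> S \<and> length I = k}. h (i # I))"
proof -
  let ?L = "\<lambda>k. {I. set I \<subseteq> S \<and> length I = k}"
  have "(\<Sum>i\<in>S. \<Sum>I\<in>?L k. h (i # I)) = (\<Sum>(i, I)\<in>S \<times> ?L k. h (i # I))"
    by (rule sum.cartesian_product)
  also have "\<dots> = (\<Sum>I\<in>?L (Suc k). h I)"
    by (rule sum.reindex_bij_witness [of _ "\<lambda>I. (hd I, tl I)" "\<lambda>(i, I). i # I"])
      (auto simp: length_Suc_conv)
  finally show ?thesis by simp
qed

lemma sum_lists_0: "(\<Sum>I\<in>{I. set I \<subseteq> S \<and> length I = 0}. h I) = h []"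
proof -
  have "{I. set I \<subseteq> S \<and> length I = 0} = {[]}" by auto
  then show ?thesis by simp
qed

text \<open>Imposed on lists of every length, unlike \<open>is_covector\<close>, so that it passes
  to contractions and to wedge products without counting degrees; covectors that vanish in the wrong
  degree satisfy it.\<close>

definition multilin :: "covector \<Rightarrow> bool" where
  "multilin \<omega> \<longleftrightarrow> (\<forall>us vs. linear (\<lambda>v. \<omega> (us @ v # vs)))"

definition antisym_form :: "covector \<Rightarrow> bool" where
  "antisym_form \<omega> \<longleftrightarrow> (\<forall>us v w vs. \<omega> (us @ v # w # vs) = - \<omega> (us @ w # v # vs))"

lemma multilin_linear_at: "multilin \<omega> \<Longrightarrow> linear (\<lambda>v. \<omega> (us @ v # vs))"
  by (simp add: multilin_def)

lemma antisym_form_at: "antisym_form \<omega> \<Longrightarrow> \<omega> (us @ v # w # vs) = - \<omega> (us @ w # v # vs)"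
  unfolding antisym_form_def by blast

lemma multilin_Cons: "multilin \<omega> \<Longrightarrow> multilin (\<lambda>us. \<omega> (u # us))"
  using multilin_linear_at [of \<omega> "u # _"] by (simp add: multilin_def)

lemma antisym_form_Cons: "antisym_form \<omega> \<Longrightarrow> antisym_form (\<lambda>us. \<omega> (u # us))"
  using antisym_form_at [of \<omega> "u # _"] unfolding antisym_form_def append_Cons by blast

lemma antisym_form_append: "antisym_form \<omega> \<Longrightarrow> antisym_form (\<lambda>us. \<omega> (us @ vs))"
  using antisym_form_at [of \<omega> _ _ _ "_ @ vs"]
  unfolding antisym_form_def append_assoc append_Cons by blast

lemma multilin_linear: "multilin \<omega> \<Longrightarrow> linear (\<lambda>v. \<omega> (v # vs))"
  using multilin_linear_at [of \<omega> "[]"] by simp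

lemma linear_sum_fun:
  "(\<And>i. i \<in> S \<Longrightarrow> linear (f i)) \<Longrightarrow> linear (\<lambda>v. \<Sum>i\<in>S. f i v :: real)"
  by (rule linear_compose_sum) auto

lemma linear_mult_left: "linear f \<Longrightarrow> linear (\<lambda>v. a * f v :: real)"
  using linear_compose_scale_right [of f a] by simp

lemma multilin_wedge1:
  assumes "linear (\<lambda>v. \<alpha> [v])" "multilin \<beta>"
  shows "multilin (wedge1 \<alpha> \<beta>)"
  unfolding multilin_def
proof (intro allI)
  show "linear (\<lambda>v. wedge1 \<alpha> \<beta> (us @ v # vs))" for us vs
    using assms(2)
  proof (induction us arbitrary: \<beta>)
    case Nil
    have "linear (\<lambda>v. \<beta> (v # us))" for us
      using Nil by (rule multilin_linear)
    then have "linear (\<lambda>v. wedge1 \<alpha> (\<lambda>us. \<beta> (v # us)) vs)"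
      unfolding wedge1_def by (intro linear_sum_fun linear_mult_left) auto
    moreover have "linear (\<lambda>v. \<beta> vs * \<alpha> [v])"
      by (intro linear_mult_left assms)
    ultimately show ?case
      by (simp add: wedge1_Cons linear_compose_sub mult.commute)
  next
    case (Cons u us)
    have "linear (\<lambda>v. \<beta> (us @ v # vs))"
      using Cons.prems by (simp add: multilin_def)
    moreover have "linear (\<lambda>v. wedge1 \<alpha> (\<lambda>ws. \<beta> (u # ws)) (us @ v # vs))"
      by (rule Cons.IH) (rule multilin_Cons [OF Cons.prems])
    ultimately show ?case
      by (simp add: wedge1_Cons linear_compose_sub linear_mult_left)
  qed
qed

lemma antisym_form_wedge1:
  assumes "antisym_form \<beta>"
  shows "antisym_form (wedge1 \<alpha> \<beta>)"
  unfolding antisym_form_def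
proof (intro allI)
  show "wedge1 \<alpha> \<beta> (us @ v # w # vs) = - wedge1 \<alpha> \<beta> (us @ w # v # vs)" for us v w vs
    using assms
  proof (induction us arbitrary: \<beta>)
    case Nil
    have "(\<lambda>us. \<beta> (v # w # us)) = (\<lambda>us. -1 * \<beta> (w # v # us))"
      using antisym_form_at [OF Nil, of "[]" v w] by (simp add: fun_eq_iff)
    then have "wedge1 \<alpha> (\<lambda>us. \<beta> (v # w # us)) vs = wedge1 \<alpha> (\<lambda>us. -1 * \<beta> (w # v # us)) vs"
      by (rule arg_cong)
    then have "wedge1 \<alpha> (\<lambda>us. \<beta> (v # w # us)) vs = - wedge1 \<alpha> (\<lambda>us. \<beta> (w # v # us)) vs"
      unfolding wedge1_mult by simp
    then show ?case by (simp add: wedge1_Cons)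
  next
    case (Cons u us)
    have "\<beta> (us @ v # w # vs) = - \<beta> (us @ w # v # vs)"
      by (rule antisym_form_at [OF Cons.prems])
    then show ?case
      using Cons.IH [OF antisym_form_Cons [OF Cons.prems]] by (simp add: wedge1_Cons)
  qed
qed

lemma multilin_cov_mono:
  "(\<And>i. i \<in> set I \<Longrightarrow> linear (\<lambda>v. x i [v])) \<Longrightarrow> multilin (cov_mono x I)"
proof (induction I)
  case Nil
  have "linear (\<lambda>v::vec. 0::real)"
    by (rule module_hom_zero)
  then show ?case by (simp add: multilin_def unit_covector_def)
qed (simp add: multilin_wedge1)

lemma antisym_form_cov_mono: "antisym_form (cov_mono x I)"
  by (induction I) (simp_all add: antisym_form_wedge1, simp add: antisym_form_def unit_covector_def)

lemma multilin_lincomb: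
  "(\<And>a I i. (a, I) \<in> set ts \<Longrightarrow> i \<in> set I \<Longrightarrow> linear (\<lambda>v. x i [v])) \<Longrightarrow> multilin (lincomb x ts)"
proof (induction ts)
  case Nil
  have "linear (\<lambda>v::vec. 0::real)"
    by (rule module_hom_zero)
  then show ?case by (simp add: multilin_def)
next
  case (Cons t ts)
  obtain a I where t: "t = (a, I)" by force
  have 1: "multilin (cov_mono x I)" 
    by (rule multilin_cov_mono, rule Cons.prems) (auto simp: t)
  have 2: "multilin (lincomb x ts)" by (rule Cons.IH, rule Cons.prems) auto
  from 1 2 show ?case
    unfolding multilin_def t lincomb_Cons by (auto intro!: linear_compose_add linear_mult_left)
qed

lemma antisym_form_lincomb: "antisym_form (lincomb x ts)"
proof (induction ts)
  case (Cons t ts)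
  obtain a I where t: "t = (a, I)" by force
  show ?case
    unfolding antisym_form_def t lincomb_Cons
  proof (intro allI)
    show "a * cov_mono x I (us @ v # w # vs) + lincomb x ts (us @ v # w # vs)
        = - (a * cov_mono x I (us @ w # v # vs) + lincomb x ts (us @ w # v # vs))" for us v w vs
      using antisym_form_at [OF antisym_form_cov_mono [of x I], of us v w vs]
        antisym_form_at [OF Cons, of us v w vs] by simp
  qed
qed (simp add: antisym_form_def)

lemma antisym_form_move:
  assumes "antisym_form \<omega>"
  shows "\<omega> (us @ v # ms @ w # vs) = (-1) ^ length ms * \<omega> (us @ v # w # ms @ vs)"
proof (induction ms arbitrary: vs rule: rev_induct)
  case (snoc m ms)
  have "\<omega> (us @ v # (ms @ [m]) @ w # vs) = - \<omega> (us @ v # ms @ w # m # vs)"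
    using antisym_form_at [OF assms, of "us @ v # ms" m w vs] by simp
  then show ?case using snoc [of "m # vs"] by simp
qed simp

text \<open>Moving the second copy of \<open>v\<close> next to the first changes only the sign, and
  exchanging equal neighbours then shows that the value is its own negative.\<close>

lemma antisym_form_repeat:
  assumes "antisym_form \<omega>"
  shows "\<omega> (us @ v # ms @ v # vs) = 0"
  using antisym_form_move [OF assms, of us v ms v vs] antisym_form_at [OF assms, of us v v "ms @ vs"]
  by simp

lemma is_covectorI:
  assumes "multilin \<omega>" "antisym_form \<omega>"
  shows "is_covector k \<omega>"
  unfolding is_covector_def
proof (intro allI impI conjI)
  fix vs :: "vec list" and i
  assume "length vs = k" "i < k"
  then have "vs[i := v] = take i vs @ v # drop (Suc i) vs" for v
    by (simp add: upd_conv_take_nth_drop)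
  then show "linear (\<lambda>v. \<omega> (vs[i := v]))"
    using assms(1) by (simp add: multilin_def)
next
  have *: "\<omega> vs = 0" if "i < j" "j < length vs" "vs ! i = vs ! j" for i j and vs :: "vec list"
  proof -
    have *: "take j vs = take i vs @ vs ! i # drop (Suc i) (take j vs)"
      using that id_take_nth_drop [of i "take j vs"] by (simp add: min_def)
    have "vs = take j vs @ vs ! j # drop (Suc j) vs"
      using that(2) by (rule id_take_nth_drop)
    also have "\<dots> = take i vs @ vs ! i # drop (Suc i) (take j vs) @ vs ! j # drop (Suc j) vs"
      using arg_cong [OF *, of "\<lambda>us. us @ vs ! j # drop (Suc j) vs"] by simp
    finally show ?thesis
      using antisym_form_repeat [OF assms(2)] that(3) by metis
  qed
  fix vs :: "vec list" and i j
  assume "length vs = k" "i < k" "j < k" "i \<noteq> j \<and> vs ! i = vs ! j"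
  then show "\<omega> vs = 0"
    using * [of i j vs] * [of j i vs] by (cases "i < j") auto
qed

lemma is_covector_1_linear: "is_covector 1 \<alpha> \<Longrightarrow> linear (\<lambda>v. \<alpha> [v])"
  unfolding is_covector_def by (drule spec [of _ "[0]"]) simp

lemma is_covector_lincomb:
  assumes "\<And>a I i. (a, I) \<in> set ts \<Longrightarrow> i \<in> set I \<Longrightarrow> is_covector 1 (x i)"
  shows "is_covector k (lincomb x ts)"
proof (rule is_covectorI [OF multilin_lincomb antisym_form_lincomb])
  fix a I i assume "(a, I) \<in> set ts" "i \<in> set I"
  then show "linear (\<lambda>v. x i [v])" by (intro is_covector_1_linear assms)
qed

section \<open>Dual frames\<close>

definition dual_frame :: "(nat \<Rightarrow> covector) \<Rightarrow> (nat \<Rightarrow> vec) \<Rightarrow> bool" where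
  "dual_frame x F \<longleftrightarrow> (\<forall>i\<in>{1..7}. \<forall>j\<in>{1..7}. x i [F j] = (if i = j then 1 else 0))"

text \<open>Coframes are indexed by the naturals 1 to 7, matrices by the type \<open>7\<close>. An
  arbitrary bijection carries the matrix results over.\<close>

lemma obtain_index_bij:
  obtains h :: "7 \<Rightarrow> nat" where "bij_betw h UNIV {1..7}"
proof -
  have "card (UNIV :: 7 set) = card {1..7::nat}" by simp
  then show ?thesis
    using that finite_same_card_bij [of "UNIV :: 7 set" "{1..7::nat}"] by auto
qed

text \<open>A one-sided inverse of a square matrix is two-sided. This turns orthonormality of the
  rows of a transition matrix into orthonormality of its columns.\<close>

lemma right_inverse_left_inverse:
  fixes P Q :: "nat \<Rightarrow> nat \<Rightarrow> real"
  assumes PQ: "\<And>i j. i \<in> {1..7} \<Longrightarrow> j \<in> {1..7} \<Longrightarrow>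
      (\<Sum>k\<in>{1..7}. P i k * Q k j) = (if i = j then 1 else 0)"
    and "i \<in> {1..7}" "j \<in> {1..7}"
  shows "(\<Sum>k\<in>{1..7}. Q i k * P k j) = (if i = j then 1 else 0)"
proof -
  obtain h :: "7 \<Rightarrow> nat" where h: "bij_betw h UNIV {1..7}" by (rule obtain_index_bij)
  define p q :: "real ^ 7 ^ 7" where "p = (\<chi> a b. P (h a) (h b))" "q = (\<chi> a b. Q (h a) (h b))"
  have re: "(\<Sum>c\<in>UNIV. g (h c)) = (\<Sum>k\<in>{1..7}. g k)" for g :: "nat \<Rightarrow> real"
    using h by (rule sum.reindex_bij_betw)
  have in_h: "h a \<in> {1..7}" for a using h by (auto simp: bij_betw_def)
  have inj: "h a = h b \<longleftrightarrow> a = b" for a b using h by (auto simp: bij_betw_def inj_on_def)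
  have "p ** q = mat 1"
    using PQ [OF in_h in_h]
    by (simp add: p_q_def matrix_matrix_mult_def mat_def vec_eq_iff re [of "\<lambda>k. P _ k * Q k _"] inj)
  then have "q ** p = mat 1" by (simp add: matrix_left_right_inverse)
  then have *: "(\<Sum>k\<in>{1..7}. Q (h a) k * P k (h b)) = (if a = b then 1 else 0)" for a b
    by (simp add: p_q_def matrix_matrix_mult_def mat_def vec_eq_iff re [of "\<lambda>k. Q _ k * P k _"])
  have "i \<in> range h" "j \<in> range h"
    using assms(2,3) bij_betw_imp_surj_on [OF h] by simp_all
  then obtain a b where "i = h a" "j = h b" by blast
  then show ?thesis using * [of a b] by (simp add: inj)
qed

lemma linear_components:
  assumes "linear (f :: vec \<Rightarrow> real)"
  shows "f v = (\<Sum>b\<in>UNIV. v $ b * f (axis b 1))"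
proof -
  have "f v = f (\<Sum>b\<in>UNIV. v $ b *\<^sub>R axis b 1)"
    using basis_expansion [of v] by (simp add: scalar_mult_eq_scaleR)
  also have "\<dots> = (\<Sum>b\<in>UNIV. v $ b * f (axis b 1))"
    by (simp add: linear_sum [OF assms] linear_scale [OF assms])
  finally show ?thesis .
qed

lemma coframe_linear: "is_coframe x \<Longrightarrow> i \<in> {1..7} \<Longrightarrow> linear (\<lambda>v. x i [v])"
  by (intro is_covector_1_linear) (simp add: is_coframe_def)

text \<open>The matrix of the coframe in the standard basis has independent rows, hence a right
  inverse; the columns of that inverse are the dual vectors.\<close>

lemma dual_frame_exists:
  assumes "is_coframe x"
  obtains F where "dual_frame x F"
proof -
  obtain h :: "7 \<Rightarrow> nat" where h: "bij_betw h UNIV {1..7}" by (rule obtain_index_bij)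
  have in_h: "h a \<in> {1..7}" for a using h by (auto simp: bij_betw_def)
  have inj: "inj h" using h by (auto simp: bij_betw_def)
  define X :: "real ^ 7 ^ 7" where "X = (\<chi> a b. x (h a) [axis b 1])"
  have "\<forall>a. c a = 0" if c: "(\<Sum>a\<in>UNIV. c a *s row a X) = 0" for c
  proof -
    define a where "a = (\<lambda>i. c (inv_into UNIV h i))"
    have comp: "(\<Sum>a\<in>UNIV. c a * x (h a) [axis b 1]) = 0" for b
      using arg_cong [OF c, of "\<lambda>v. v $ b"] by (simp add: X_def row_def)
    have "(\<Sum>i\<in>{1..7}. a i * x i [v]) = 0" for v
    proof -
      have "(\<Sum>i\<in>{1..7}. a i * x i [v]) = (\<Sum>k\<in>UNIV. c k * x (h k) [v])"
        using sum.reindex_bij_betw [OF h, of "\<lambda>i. a i * x i [v]"] inj by (simp add: a_def)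
      also have "\<dots> = (\<Sum>k\<in>UNIV. \<Sum>b\<in>UNIV. v $ b * (c k * x (h k) [axis b 1]))"
        using linear_components [OF coframe_linear [OF assms in_h], where v = v]
        by (simp add: sum_distrib_left mult.left_commute)
      also have "\<dots> = (\<Sum>b\<in>UNIV. v $ b * (\<Sum>k\<in>UNIV. c k * x (h k) [axis b 1]))"
        by (subst sum.swap) (simp add: sum_distrib_left)
      finally show ?thesis by (simp add: comp)
    qed
    then have "\<forall>i\<in>{1..7}. a i = 0" using assms by (simp add: is_coframe_def)
    then show ?thesis using in_h inj by (force simp: a_def)
  qed
  then have "\<exists>B. X ** B = mat 1"
    unfolding matrix_right_invertible_independent_rows by blast
  then obtain B where B: "X ** B = mat 1" by blast
  define F where "F = (\<lambda>j. column (inv_into UNIV h j) B)"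
  have XB: "x (h a) [F (h b)] = (if a = b then 1 else 0)" for a b
    using B linear_components [OF coframe_linear [OF assms in_h], where v = "F (h b)"]
    by (simp add: F_def inj column_def X_def matrix_matrix_mult_def mat_def vec_eq_iff mult.commute)
  have "dual_frame x F"
    unfolding dual_frame_def
  proof (intro ballI)
    fix i j assume "i \<in> {1..7::nat}" "j \<in> {1..7::nat}"
    then have "i \<in> range h" "j \<in> range h"
      using bij_betw_imp_surj_on [OF h] by simp_all
    then obtain a b where "i = h a" "j = h b" by blast
    then show "x i [F j] = (if i = j then 1 else 0)"
      using XB inj by (simp add: inj_eq)
  qed
  then show ?thesis by (rule that)
qed

text \<open>Duality says that the coframe matrix times the frame matrix is the identity. The product
  in the other order is then the identity too, which is the expansion of the standard basis.\<close>

lemma dual_frame_expansion: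
  assumes "is_coframe x" "dual_frame x F"
  shows "(\<Sum>j\<in>{1..7}. x j [v] *\<^sub>R F j) = v"
proof -
  obtain h :: "7 \<Rightarrow> nat" where h: "bij_betw h UNIV {1..7}" by (rule obtain_index_bij)
  have in_h: "h a \<in> {1..7}" for a using h by (auto simp: bij_betw_def)
  have inj: "h a = h b \<longleftrightarrow> a = b" for a b using h by (auto simp: bij_betw_def inj_on_def)
  define X Y :: "real ^ 7 ^ 7" where
    "X = (\<chi> a b. x (h a) [axis b 1])" "Y = (\<chi> a b. F (h b) $ a)"
  have xv: "x (h a) [v] = (\<Sum>b\<in>UNIV. v $ b * x (h a) [axis b 1])" for a v
    using linear_components [OF coframe_linear [OF assms(1) in_h]] .
  have "X ** Y = mat 1"
    using assms(2) in_h
    by (simp add: X_Y_def matrix_matrix_mult_def mat_def vec_eq_iff mult.commute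
        xv [symmetric] dual_frame_def inj)
  then have "Y ** X = mat 1" by (simp add: matrix_left_right_inverse)
  then have *: "(\<Sum>k\<in>UNIV. F (h k) $ a * x (h k) [axis b 1]) = (if a = b then 1 else 0)" for a b
    by (simp add: X_Y_def matrix_matrix_mult_def mat_def vec_eq_iff)
  have "(\<Sum>j\<in>{1..7}. x j [v] *\<^sub>R F j) $ a = v $ a" for a
  proof -
    have "(\<Sum>j\<in>{1..7}. x j [v] *\<^sub>R F j) $ a = (\<Sum>k\<in>UNIV. x (h k) [v] * F (h k) $ a)"
      using sum.reindex_bij_betw [OF h, of "\<lambda>j. x j [v] * F j $ a"] by simp
    also have "\<dots> = (\<Sum>k\<in>UNIV. \<Sum>b\<in>UNIV. v $ b * (F (h k) $ a * x (h k) [axis b 1]))"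
      by (simp add: xv [of _ v] sum_distrib_left ac_simps)
    also have "\<dots> = (\<Sum>b\<in>UNIV. v $ b * (\<Sum>k\<in>UNIV. F (h k) $ a * x (h k) [axis b 1]))"
      by (subst sum.swap) (simp add: sum_distrib_left)
    also have "\<dots> = v $ a" by (simp add: * if_distrib cong: if_cong)
    finally show ?thesis .
  qed
  then show ?thesis by (simp add: vec_eq_iff)
qed

section \<open>Independence of the choice of an orthonormal frame\<close>

definition coframe_metric :: "(nat \<Rightarrow> covector) \<Rightarrow> vec \<Rightarrow> vec \<Rightarrow> real" where
  "coframe_metric x = (\<lambda>u v. \<Sum>i\<in>{1..7}. x i [u] * x i [v])"

lemma dual_frame_orthonormal:
  assumes "dual_frame x F"
  shows "orthonormal_frame (coframe_metric x) F"
  unfolding orthonormal_frame_def coframe_metric_def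
proof (intro ballI)
  fix i j assume ij: "i \<in> {1..7::nat}" "j \<in> {1..7::nat}"
  have "(\<Sum>k\<in>{1..7}. x k [F i] * x k [F j]) = (\<Sum>k\<in>{1..7}. if k = i then if i = j then 1 else 0 else 0)"
    using assms ij by (intro sum.cong refl) (simp add: dual_frame_def)
  then show "(\<Sum>k\<in>{1..7}. x k [F i] * x k [F j]) = (if i = j then 1 else 0)"
    using ij by simp
qed

text \<open>The transition matrix with entries \<open>x j [E i]\<close> is orthogonal, so the trace
  of a product of two linear forms is the same in both frames.\<close>

lemma orthonormal_frame_trace:
  assumes x: "is_coframe x" and F: "dual_frame x F"
    and E: "orthonormal_frame (coframe_metric x) E"
    and a: "linear a" and b: "linear b"
  shows "(\<Sum>i\<in>{1..7}. a (E i) * b (E i) :: real) = (\<Sum>i\<in>{1..7}. a (F i) * b (F i))"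
proof -
  have expand: "c (E i) = (\<Sum>j\<in>{1..7}. x j [E i] * c (F j))" if "linear c" for c :: "vec \<Rightarrow> real" and i
    using arg_cong [OF dual_frame_expansion [OF x F, of "E i"], of c] that
    by (simp add: linear_sum linear_scale)
  have ortho: "(\<Sum>i\<in>{1..7}. x j [E i] * x k [E i]) = (if j = k then 1 else 0)"
    if "j \<in> {1..7}" "k \<in> {1..7}" for j k
    using right_inverse_left_inverse [of "\<lambda>i k. x k [E i]" "\<lambda>k j. x k [E j]" j k] that E
    by (simp add: orthonormal_frame_def coframe_metric_def)
  have "(\<Sum>i\<in>{1..7}. a (E i) * b (E i))
      = (\<Sum>i\<in>{1..7}. \<Sum>j\<in>{1..7}. \<Sum>k\<in>{1..7}. a (F j) * b (F k) * (x j [E i] * x k [E i]))"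
    unfolding expand [OF a] expand [OF b] sum_product by (intro sum.cong refl) simp
  also have "\<dots> = (\<Sum>j\<in>{1..7}. \<Sum>i\<in>{1..7}. \<Sum>k\<in>{1..7}. a (F j) * b (F k) * (x j [E i] * x k [E i]))"
    by (rule sum.swap)
  also have "\<dots> = (\<Sum>j\<in>{1..7}. \<Sum>k\<in>{1..7}. \<Sum>i\<in>{1..7}. a (F j) * b (F k) * (x j [E i] * x k [E i]))"
    by (rule sum.cong [OF refl], rule sum.swap)
  also have "\<dots> = (\<Sum>j\<in>{1..7}. \<Sum>k\<in>{1..7}. a (F j) * b (F k) * (if j = k then 1 else 0))"
    by (intro sum.cong refl) (simp only: sum_distrib_left [symmetric] ortho)
  finally show ?thesis by (simp add: if_distrib cong: if_cong)
qed

abbreviation index_lists :: "nat \<Rightarrow> nat list set" where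
  "index_lists k \<equiv> {I. set I \<subseteq> {1..7} \<and> length I = k}"

text \<open>The frame is exchanged one slot at a time: the tail by induction with the first vector
  fixed, then, after swapping the sums, the first slot by
  \<open>orthonormal_frame_trace\<close>.\<close>

lemma orthonormal_frame_multitrace:
  assumes x: "is_coframe x" and F: "dual_frame x F"
    and E: "orthonormal_frame (coframe_metric x) E"
    and "multilin \<omega>" "multilin \<eta>"
  shows "(\<Sum>I\<in>index_lists k. \<omega> (map E I) * \<eta> (map E I))
    = (\<Sum>I\<in>index_lists k. \<omega> (map F I) * \<eta> (map F I))"
  using assms(4,5)
proof (induction k arbitrary: \<omega> \<eta>)
  case (Suc k)
  have "(\<Sum>I\<in>index_lists (Suc k). \<omega> (map E I) * \<eta> (map E I))
      = (\<Sum>i\<in>{1..7}. \<Sum>I\<in>index_lists k. \<omega> (E i # map E I) * \<eta> (E i # map E I))"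
    by (subst sum_lists_Suc) simp_all
  also have "\<dots> = (\<Sum>i\<in>{1..7}. \<Sum>I\<in>index_lists k. \<omega> (E i # map F I) * \<eta> (E i # map F I))"
    by (intro sum.cong refl Suc.IH multilin_Cons Suc.prems)
  also have "\<dots> = (\<Sum>I\<in>index_lists k. \<Sum>i\<in>{1..7}. \<omega> (E i # map F I) * \<eta> (E i # map F I))"
    by (rule sum.swap)
  also have "\<dots> = (\<Sum>I\<in>index_lists k. \<Sum>i\<in>{1..7}. \<omega> (F i # map F I) * \<eta> (F i # map F I))"
    by (intro sum.cong refl orthonormal_frame_trace [OF x F E] multilin_linear Suc.prems)
  also have "\<dots> = (\<Sum>i\<in>{1..7}. \<Sum>I\<in>index_lists k. \<omega> (F i # map F I) * \<eta> (F i # map F I))"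
    by (rule sum.swap)
  also have "\<dots> = (\<Sum>I\<in>index_lists (Suc k). \<omega> (map F I) * \<eta> (map F I))"
    by (subst sum_lists_Suc) simp_all
  finally show ?case .
qed (simp add: sum_lists_0)

text \<open>Moving the removed entry to the front inside the antisymmetric form costs exactly the
  sign that the alternating sum carries, so all k + 1 positions contribute equally.\<close>

lemma sum_altsum_antisym:
  fixes F :: "nat \<Rightarrow> vec" and h :: "nat \<Rightarrow> nat list \<Rightarrow> real"
  assumes "antisym_form \<eta>"
  shows "(\<Sum>I\<in>index_lists (Suc k). altsum h I * \<eta> (map F I))
    = real (Suc k) * (\<Sum>i\<in>{1..7}. \<Sum>I\<in>index_lists k. h i I * \<eta> (F i # map F I))"
  using assms
proof (induction k arbitrary: h \<eta>)
  case 0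
  then show ?case by (simp add: sum_lists_Suc sum_lists_0 del: length_0_conv)
next
  case (Suc k)
  have swap: "\<eta> (F i # F j # map F I) = - \<eta> (F j # F i # map F I)" for i j I
    using antisym_form_at [OF Suc.prems, of "[]" "F i" "F j" "map F I"] by simp
  have "(\<Sum>I\<in>index_lists (Suc (Suc k)). altsum h I * \<eta> (map F I))
      = (\<Sum>i\<in>{1..7}. \<Sum>I\<in>index_lists (Suc k). h i I * \<eta> (F i # map F I))
      - (\<Sum>i\<in>{1..7}. \<Sum>I\<in>index_lists (Suc k). altsum (\<lambda>u us. h u (i # us)) I * \<eta> (F i # map F I))"
    by (subst sum_lists_Suc) (simp_all add: sum_subtractf left_diff_distrib)
  also have "(\<Sum>i\<in>{1..7}. \<Sum>I\<in>index_lists (Suc k). altsum (\<lambda>u us. h u (i # us)) I * \<eta> (F i # map F I))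
      = (\<Sum>i\<in>{1..7}. real (Suc k) * (\<Sum>j\<in>{1..7}. \<Sum>I\<in>index_lists k.
            h j (i # I) * \<eta> (F i # F j # map F I)))"
    by (intro sum.cong refl Suc.IH antisym_form_Cons Suc.prems)
  also have "\<dots> = - (real (Suc k) * (\<Sum>i\<in>{1..7}. \<Sum>j\<in>{1..7}. \<Sum>I\<in>index_lists k.
            h j (i # I) * \<eta> (F j # F i # map F I)))"
    unfolding sum_distrib_left sum_negf [symmetric]
    by (intro sum.cong refl) (subst swap, simp)
  also have "(\<Sum>i\<in>{1..7}. \<Sum>j\<in>{1..7}. \<Sum>I\<in>index_lists k. h j (i # I) * \<eta> (F j # F i # map F I))
      = (\<Sum>j\<in>{1..7}. \<Sum>I\<in>index_lists (Suc k). h j I * \<eta> (F j # map F I))"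
    by (subst sum.swap) (simp add: sum_lists_Suc)
  finally show ?case by (simp add: algebra_simps)
qed

text \<open>Each index of the monomial contributes one factor of \<open>sum_altsum_antisym\<close>.
  Together they give the factorial that the Hodge star divides by.\<close>

lemma sum_cov_mono_antisym:
  assumes F: "dual_frame x F" and "antisym_form \<eta>" "set J \<subseteq> {1..7}"
  shows "(\<Sum>I\<in>index_lists (length J). cov_mono x J (map F I) * \<eta> (map F I))
    = fact (length J) * \<eta> (map F J)"
  using assms(2,3)
proof (induction J arbitrary: \<eta>)
  case (Cons j J)
  let ?h = "\<lambda>u us. x j [F u] * cov_mono x J (map F us)"
  have "(\<Sum>I\<in>index_lists (length (j # J)). cov_mono x (j # J) (map F I) * \<eta> (map F I))
      = (\<Sum>I\<in>index_lists (Suc (length J)). altsum ?h I * \<eta> (map F I))"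
    by (simp add: wedge1_altsum altsum_map)
  also have "\<dots> = real (Suc (length J)) * (\<Sum>i\<in>{1..7}. x j [F i] *
      (\<Sum>I\<in>index_lists (length J). cov_mono x J (map F I) * \<eta> (F i # map F I)))"
    by (subst sum_altsum_antisym [OF Cons.prems(1)]) (simp add: sum_distrib_left mult.assoc)
  also have "(\<Sum>i\<in>{1..7}. x j [F i] *
      (\<Sum>I\<in>index_lists (length J). cov_mono x J (map F I) * \<eta> (F i # map F I)))
      = (\<Sum>i\<in>{1..7}. (if j = i then fact (length J) * \<eta> (F j # map F J) else 0))"
  proof (intro sum.cong refl)
    fix i assume "i \<in> {1..7::nat}"
    moreover have "(\<Sum>I\<in>index_lists (length J). cov_mono x J (map F I) * \<eta> (F i # map F I))
        = fact (length J) * \<eta> (F i # map F J)"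
      using Cons.prems(2) by (intro Cons.IH antisym_form_Cons Cons.prems(1)) simp
    ultimately show "x j [F i] * (\<Sum>I\<in>index_lists (length J). cov_mono x J (map F I) * \<eta> (F i # map F I))
        = (if j = i then fact (length J) * \<eta> (F j # map F J) else 0)"
      using F Cons.prems(2) by (simp add: dual_frame_def)
  qed
  also have "\<dots> = fact (length J) * \<eta> (F j # map F J)"
    using Cons.prems(2) by simp
  finally show ?case by simp
qed (simp add: sum_lists_0 unit_covector_def del: length_0_conv)

text \<open>Interior product with the i-th vector of the dual frame. Terms whose coefficient would
  be 0 are dropped at once, which keeps the evaluated lists short.\<close>

primrec contract_index :: "nat \<Rightarrow> nat list \<Rightarrow> terms" where
  "contract_index i [] = []"
| "contract_index i (j # J) =
     (if j = i then [(1, J)] else []) @ map (\<lambda>(a, K). (- a, j # K)) (contract_index i J)"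

definition contract_index_terms :: "nat \<Rightarrow> terms \<Rightarrow> terms" where
  "contract_index_terms i ts = concat (map (\<lambda>(a, I). a \<cdot>\<^sub>t contract_index i I) ts)"

text \<open>In \<open>hodge\<close> the traced arguments come first in the volume form. Hence the
  star of a monomial is the volume form contracted with the dual vectors of its indices, in their
  order.\<close>

definition star_terms :: "terms \<Rightarrow> terms" where
  "star_terms ts = concat (map (\<lambda>(a, I). a \<cdot>\<^sub>t fold contract_index_terms I [(1, [1,2,3,4,5,6,7])]) ts)"

lemma lincomb_contract_index:
  assumes F: "dual_frame x F" and i: "i \<in> {1..7}" and "set I \<subseteq> {1..7}"
  shows "lincomb x (contract_index i I) vs = cov_mono x I (F i # vs)"
  using assms(3)
proof (induction I arbitrary: vs)
  case (Cons j J)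
  have "set J \<subseteq> {1..7}" "j \<in> {1..7}" using Cons.prems by auto
  moreover from this have "lincomb x (contract_index i J) = (\<lambda>us. cov_mono x J (F i # us))"
    using Cons.IH by blast
  ultimately show ?case
    using lincomb_Cons_index [of x "-1" j "contract_index i J" vs] F i
    by (simp add: lincomb_append lincomb_Cons wedge1_Cons dual_frame_def)
qed (simp add: unit_covector_def)

lemma lincomb_contract_index_terms:
  assumes F: "dual_frame x F" and i: "i \<in> {1..7}" and "\<And>a I. (a, I) \<in> set ts \<Longrightarrow> set I \<subseteq> {1..7}"
  shows "lincomb x (contract_index_terms i ts) vs = lincomb x ts (F i # vs)"
  using assms(3)
proof (induction ts)
  case (Cons t ts)
  obtain a I where t: "t = (a, I)" by force
  have "set I \<subseteq> {1..7}" using Cons.prems [of a I] t by simp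
  moreover have "lincomb x (contract_index_terms i ts) vs = lincomb x ts (F i # vs)"
    by (rule Cons.IH, rule Cons.prems) auto
  ultimately show ?case
    by (simp add: t contract_index_terms_def lincomb_append lincomb_scale lincomb_Cons
        lincomb_contract_index [OF F i])
qed (simp add: contract_index_terms_def)

lemma contract_index_terms_indices:
  assumes "\<And>a I. (a, I) \<in> set ts \<Longrightarrow> set I \<subseteq> S" "(a, J) \<in> set (contract_index_terms i ts)"
  shows "set J \<subseteq> S"
proof -
  have "set J \<subseteq> set I" if "(a, J) \<in> set (contract_index i I)" for a J I
    using that by (induction I arbitrary: a J) (fastforce split: if_splits)+
  then show ?thesis
    using assms unfolding contract_index_terms_def scale_terms_def by fastforce
qed

lemma lincomb_fold_contract:
  assumes F: "dual_frame x F" and "set I \<subseteq> {1..7}" and "\<And>a J. (a, J) \<in> set ts \<Longrightarrow> set J \<subseteq> {1..7}"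
  shows "lincomb x (fold contract_index_terms I ts) vs = lincomb x ts (map F I @ vs)"
  using assms(2,3)
proof (induction I arbitrary: ts)
  case (Cons i I)
  have "set J \<subseteq> {1..7}" if "(a, J) \<in> set (contract_index_terms i ts)" for a J
    using contract_index_terms_indices [OF Cons.prems(2) that] .
  moreover have "set I \<subseteq> {1..7}" "i \<in> {1..7}" using Cons.prems(1) by auto
  ultimately show ?case
    using Cons.IH [of "contract_index_terms i ts"]
      lincomb_contract_index_terms [OF F \<open>i \<in> {1..7}\<close> Cons.prems(2)] by simp
qed simp

text \<open>The chosen frame is replaced by a dual frame through
  \<open>orthonormal_frame_multitrace\<close>, where the sum over index lists collapses and its
  factorial cancels. The equality holds for argument lists of every length.\<close>

lemma hodge_lincomb:
  assumes x: "is_coframe x"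
    and \<omega>: "\<And>vs. length vs = k \<Longrightarrow> \<omega> vs = lincomb x ts vs"
    and ts: "\<And>a I. (a, I) \<in> set ts \<Longrightarrow> length I = k \<and> set I \<subseteq> {1..7}"
  shows "hodge (coframe_metric x) (cov_mono x [1,2,3,4,5,6,7]) k \<omega> = lincomb x (star_terms ts)"
proof
  fix vs
  let ?vol = "lincomb x [(1, [1,2,3,4,5,6,7])]"
  obtain F where F: "dual_frame x F" using dual_frame_exists [OF x] .
  define E where "E = (SOME E. orthonormal_frame (coframe_metric x) E)"
  have E: "orthonormal_frame (coframe_metric x) E"
    unfolding E_def by (rule someI [of "orthonormal_frame _", OF dual_frame_orthonormal [OF F]])
  have lin: "linear (\<lambda>v. x i [v])" if "i \<in> {1..7}" for i
    using coframe_linear [OF x that] .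
  have "multilin (lincomb x ts)"
    by (rule multilin_lincomb, rule lin) (use ts in blast)
  moreover have "multilin ?vol"
    by (rule multilin_lincomb, rule lin) auto
  then have "multilin (\<lambda>us. ?vol (us @ vs))"
    by (simp add: multilin_def)
  ultimately have "(\<Sum>I\<in>index_lists k. lincomb x ts (map E I) * ?vol (map E I @ vs))
      = (\<Sum>I\<in>index_lists k. lincomb x ts (map F I) * ?vol (map F I @ vs))"
    by (rule orthonormal_frame_multitrace [OF x F E])
  also have "\<dots> = fact k * lincomb x (star_terms ts) vs"
    using ts
  proof (induction ts)
    case (Cons t ts)
    obtain a J where t: "t = (a, J)" by force
    then have J: "length J = k" "set J \<subseteq> {1..7}"
      using Cons.prems [of a J] by simp_all
    have IH: "(\<Sum>I\<in>index_lists k. lincomb x ts (map F I) * ?vol (map F I @ vs))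
        = fact k * lincomb x (star_terms ts) vs"
      by (rule Cons.IH, rule Cons.prems) auto
    have "antisym_form ?vol" by (rule antisym_form_lincomb)
    then have "antisym_form (\<lambda>us. ?vol (us @ vs))" by (rule antisym_form_append)
    from sum_cov_mono_antisym [OF F this J(2)]
    have *: "(\<Sum>I\<in>index_lists k. cov_mono x J (map F I) * ?vol (map F I @ vs))
        = fact k * ?vol (map F J @ vs)"
      by (simp only: J(1))
    have "(\<Sum>I\<in>index_lists k. lincomb x (t # ts) (map F I) * ?vol (map F I @ vs))
        = a * (\<Sum>I\<in>index_lists k. cov_mono x J (map F I) * ?vol (map F I @ vs))
        + (\<Sum>I\<in>index_lists k. lincomb x ts (map F I) * ?vol (map F I @ vs))"
      by (simp only: t lincomb_Cons sum_distrib_left distrib_right sum.distrib mult.assoc)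
    also have "\<dots> = fact k * (a * ?vol (map F J @ vs) + lincomb x (star_terms ts) vs)"
      unfolding * IH by (simp add: algebra_simps)
    also have "?vol (map F J @ vs) = lincomb x
        (fold contract_index_terms J [(1, [1,2,3,4,5,6,7])]) vs"
      by (subst lincomb_fold_contract [OF F J(2)]) auto
    finally show ?case
      by (simp add: t star_terms_def lincomb_append lincomb_scale)
  qed (simp add: star_terms_def)
  finally have "(\<Sum>I\<in>index_lists k. lincomb x ts (map E I) * ?vol (map E I @ vs)) / fact k
      = lincomb x (star_terms ts) vs"
    by simp
  moreover have "(\<Sum>I\<in>index_lists k. \<omega> (map E I) * cov_mono x [1,2,3,4,5,6,7] (map E I @ vs))
      = (\<Sum>I\<in>index_lists k. lincomb x ts (map E I) * ?vol (map E I @ vs))"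
    by (rule sum.cong) (auto simp: \<omega> lincomb_Cons simp del: cov_mono_Cons)
  ultimately show "hodge (coframe_metric x) (cov_mono x [1,2,3,4,5,6,7]) k \<omega> vs = lincomb x (star_terms ts) vs"
    unfolding hodge_def Let_def E_def [symmetric] by simp
qed

section \<open>Metric and volume of a \<open>G\<^sub>2\<close>-structure\<close>

text \<open>From here on monomials must stay closed: they are the atoms of the comparisons by
  sorting.\<close>

declare cov_mono_Cons [simp del]

lemma sum_1_to_7: "(\<Sum>i\<in>{1..7::nat}. g i) = g 1 + g 2 + g 3 + g 4 + g 5 + g 6 + g 7"
  by (simp add: eval_nat_numeral)

definition psi_terms :: terms where
  "psi_terms = [(1, [1,2,3,4]), (1, [1,2,5,6]), (1, [3,4,5,6]), (1, [1,3,6,7]),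
                (1, [1,4,5,7]), (1, [2,3,5,7]), (-1, [2,4,6,7])]"

definition index_terms :: "(nat \<Rightarrow> real) \<Rightarrow> terms" where
  "index_terms c = map (\<lambda>i. (c i, [i])) [1,2,3,4,5,6,7]"

text \<open>With \<open>c i\<close> the value of \<open>x i\<close> on u, the contraction of phi by
  u, wedged with phi, is twice the dual 1-form of u wedged with psi. Passing through psi leaves 49
  products instead of 147 for the second wedge.\<close>

lemma contract_g2_wedge_g2:
  "lincomb x (wedge_terms (contract_terms c g2_terms) g2_terms) vs
    = lincomb x (2 \<cdot>\<^sub>t wedge_terms (index_terms c) psi_terms) vs"
proof -
  have "lincomb x (sort_terms (wedge_terms (contract_terms c g2_terms) g2_terms)) vs
    = lincomb x (sort_terms (2 \<cdot>\<^sub>t wedge_terms (index_terms c) psi_terms)) vs"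
    by (simp add: sort_terms_def wedge_terms_def contract_terms_def g2_terms_def psi_terms_def
        index_terms_def scale_terms_def lincomb_Cons)
  then show ?thesis by (simp only: lincomb_sort)
qed

lemma contract_g2_wedge_psi:
  "lincomb x (wedge_terms (contract_terms b g2_terms) (2 \<cdot>\<^sub>t wedge_terms (index_terms c) psi_terms)) vs
    = 6 * (\<Sum>i\<in>{1..7}. b i * c i) * cov_mono x [1,2,3,4,5,6,7] vs"
proof -
  have "lincomb x (sort_terms
      (wedge_terms (contract_terms b g2_terms) (2 \<cdot>\<^sub>t wedge_terms (index_terms c) psi_terms))) vs
    = 6 * (\<Sum>i\<in>{1..7}. b i * c i) * cov_mono x [1,2,3,4,5,6,7] vs"
    unfolding sum_1_to_7
    by (simp add: sort_terms_def wedge_terms_def contract_terms_def g2_terms_def psi_terms_def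
        index_terms_def scale_terms_def lincomb_Cons) (simp add: algebra_simps)
  then show ?thesis by (simp only: lincomb_sort)
qed

lemma wedge2_cong:
  assumes "\<And>us. length us + 2 = length vs \<Longrightarrow> \<beta> us = \<gamma> us"
  shows "wedge2 \<omega> \<beta> vs = wedge2 \<omega> \<gamma> vs"
  unfolding wedge2_def by (intro altsum_cong) (simp add: assms)

lemma contract_g2_length: "(a, I) \<in> set (contract_terms c g2_terms) \<Longrightarrow> length I = 2"
  by (auto simp: contract_terms_def g2_terms_def scale_terms_def)

text \<open>The identity \<open>(\<iota>\<^sub>u f) \<and> (\<iota>\<^sub>v f) \<and> f = 6 g(u, v) vol\<close>, which recovers metric and volume from the
  3-form alone; \<^const>\<open>wedge2\<close> of a 2-covector is twice its wedge product, whence the constant 24.\<close>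

lemma g2_bilinear_form:
  assumes f: "\<And>us. length us = 3 \<Longrightarrow> f us = lincomb x g2_terms us" and "length vs = 7"
  shows "wedge2 (\<lambda>a b. f [u, a, b]) (wedge2 (\<lambda>a b. f [v, a, b]) f) vs
    = 24 * coframe_metric x u v * cov_mono x [1,2,3,4,5,6,7] vs"
proof -
  let ?c = "\<lambda>w. contract_terms (\<lambda>i. x i [w]) g2_terms"
  let ?\<psi> = "2 \<cdot>\<^sub>t wedge_terms (index_terms (\<lambda>i. x i [v])) psi_terms"
  have f2: "(\<lambda>a b. f [w, a, b]) = (\<lambda>a b. lincomb x (?c w) [a, b])" for w
    by (simp add: f lincomb_contract)
  have "wedge2 (\<lambda>a b. f [v, a, b]) f us = lincomb x (2 \<cdot>\<^sub>t ?\<psi>) us" if "length us = 5" for us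
  proof -
    have "wedge2 (\<lambda>a b. f [v, a, b]) f us = wedge2 (\<lambda>a b. f [v, a, b]) (lincomb x g2_terms) us"
      by (rule wedge2_cong) (simp add: f that)
    then show ?thesis
      by (simp add: f2 wedge2_lincomb contract_g2_length contract_g2_wedge_g2 lincomb_scale)
  qed
  then have "wedge2 (\<lambda>a b. f [u, a, b]) (wedge2 (\<lambda>a b. f [v, a, b]) f) vs
      = wedge2 (\<lambda>a b. f [u, a, b]) (\<lambda>us. lincomb x (2 \<cdot>\<^sub>t ?\<psi>) us) vs"
    by (intro wedge2_cong) (simp add: \<open>length vs = 7\<close>)
  also have "\<dots> = 2 * lincomb x (wedge_terms (?c u) (2 \<cdot>\<^sub>t ?\<psi>)) vs"
    unfolding f2 by (rule wedge2_lincomb) (rule contract_g2_length)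
  also have "wedge_terms (?c u) (2 \<cdot>\<^sub>t ?\<psi>) = 2 \<cdot>\<^sub>t wedge_terms (?c u) ?\<psi>"
    by (simp add: wedge_terms_def scale_terms_def map_concat split_def o_def ac_simps)
  finally show ?thesis
    by (simp add: lincomb_scale contract_g2_wedge_psi coframe_metric_def)
qed

text \<open>Expanding along the first 1-covector, only the leading term survives: it vanishes on the
  frame vectors of all later indices, as these are distinct from the first.\<close>

lemma cov_mono_dual_frame:
  assumes "dual_frame x F" "distinct I" "set I \<subseteq> {1..7}"
  shows "cov_mono x I (map F I) = 1"
  using assms(2,3)
proof (induction I)
  case (Cons i I)
  have "cov_mono x (i # I) (F i # map F I) = x i [F i] * cov_mono x I (map F I)
      - wedge1 (x i) (\<lambda>us. cov_mono x I (F i # us)) (map F I)"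
    by (simp add: cov_mono_Cons wedge1_Cons)
  also have "wedge1 (x i) (\<lambda>us. cov_mono x I (F i # us)) (map F I) = 0"
  proof -
    have "x i [F (I ! j)] = 0" if "j < length I" for j
      using assms(1) Cons.prems nth_mem [OF that] unfolding dual_frame_def
      by (metis distinct.simps(2) list.set_intros(1) list.set_intros(2) subsetD)
    then show ?thesis by (simp add: wedge1_def)
  qed
  finally show ?case
    using assms(1) Cons by (simp add: dual_frame_def)
qed (simp add: unit_covector_def)

text \<open>The squared norm of the volume form, computed in any orthonormal frame. It takes the
  place of the statement that the volume of such a frame is 1 or -1.\<close>

lemma sum_vol_square:
  assumes x: "is_coframe x" and E: "orthonormal_frame (coframe_metric x) E"
  shows "(\<Sum>I\<in>index_lists 7. (cov_mono x [1,2,3,4,5,6,7] (map E I))\<^sup>2) = fact 7"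
proof -
  let ?J = "[1,2,3,4,5,6,7::nat]"
  obtain F where F: "dual_frame x F" using dual_frame_exists [OF x] .
  have J: "set ?J \<subseteq> {1..7}" "length ?J = 7" "distinct ?J" by auto
  have lin: "linear (\<lambda>v. x i [v])" if "i \<in> set ?J" for i
    using coframe_linear [OF x] that J(1) by blast
  have "(\<Sum>I\<in>index_lists 7. cov_mono x ?J (map E I) * cov_mono x ?J (map E I))
      = (\<Sum>I\<in>index_lists 7. cov_mono x ?J (map F I) * cov_mono x ?J (map F I))"
    by (intro orthonormal_frame_multitrace [OF x F E] multilin_cov_mono lin)
  also have "\<dots> = fact 7"
    using sum_cov_mono_antisym [OF F antisym_form_cov_mono J(1)] cov_mono_dual_frame [OF F J(3,1)]
    by (simp only: J(2) mult_1_right)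
  finally show ?thesis by (simp only: power2_eq_square)
qed

lemma adapted_unique:
  assumes x: "adapted x f" and y: "adapted y f"
  shows "coframe_metric x = coframe_metric y \<and>
    cov_mono x [1,2,3,4,5,6,7] = cov_mono y [1,2,3,4,5,6,7]"
proof -
  let ?J = "[1,2,3,4,5,6,7::nat]"
  have cx: "is_coframe x" and cy: "is_coframe y" using x y by (simp_all add: adapted_def)
  obtain F where F: "dual_frame x F" using dual_frame_exists [OF cx] .
  obtain K where K: "dual_frame y K" using dual_frame_exists [OF cy] .
  \<comment> \<open>In degree 7 both sides are 1/24 of an expression in \<open>f\<close> alone; in
    every other degree both volume forms vanish.\<close>
  have *: "coframe_metric x u v * cov_mono x ?J vs = coframe_metric y u v * cov_mono y ?J vs" for u v vs
  proof (cases "length vs = 7")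
    case True
    show ?thesis
      using g2_bilinear_form [of f x vs u v] g2_bilinear_form [of f y vs u v] x y True
      by (simp add: adapted_def)
  qed (simp add: cov_mono_length)
  txt \<open>So \<open>vol\<^sub>x = d vol\<^sub>y\<close> and \<open>g\<^sub>y = d g\<^sub>x\<close> for a scalar \<open>d > 0\<close>. A frame dual to \<open>y\<close>, rescaled by
    \<open>s = \<surd>d\<close>, is orthonormal for \<open>g\<^sub>x\<close>, and comparing norms of the volume forms gives \<open>s\<^sup>9 = 1\<close>.\<close>
  define d where "d = coframe_metric y (F 1) (F 1)"
  have "coframe_metric x (F 1) (F 1) = 1"
    using dual_frame_orthonormal [OF F] by (simp add: orthonormal_frame_def)
  then have vol: "cov_mono x ?J vs = d * cov_mono y ?J vs" for vs
    using * [of "F 1" "F 1" vs] by (simp add: d_def)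
  have volx: "cov_mono x ?J (map F ?J) = 1"
    by (rule cov_mono_dual_frame [OF F]) auto
  have "d \<ge> 0" unfolding d_def coframe_metric_def by (intro sum_nonneg) simp
  moreover have "d \<noteq> 0" using vol [of "map F ?J"] volx by auto
  ultimately have "d > 0" by simp
  have metric: "coframe_metric y u v = d * coframe_metric x u v" for u v
    using * [of u v "map F ?J"] vol [of "map F ?J"] volx by (simp add: field_simps)
  define s where "s = sqrt d"
  have s: "s * s = d" "s > 0" using \<open>d > 0\<close> by (simp_all add: s_def)
  define E where "E = (\<lambda>i. s *\<^sub>R K i)"
  have ysc: "y i [s *\<^sub>R v] = s * y i [v]" if "i \<in> {1..7}" for i v
    using linear_scale [OF coframe_linear [OF cy that]] by simp
  have "orthonormal_frame (coframe_metric x) E"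
    unfolding orthonormal_frame_def
  proof (intro ballI)
    fix i j assume ij: "i \<in> {1..7::nat}" "j \<in> {1..7::nat}"
    have "coframe_metric y (E i) (E j) = d * coframe_metric y (K i) (K j)"
      unfolding coframe_metric_def E_def s(1) [symmetric] sum_distrib_left
      by (intro sum.cong refl) (simp add: ysc)
    then have "coframe_metric x (E i) (E j) = coframe_metric y (K i) (K j)"
      using metric \<open>d > 0\<close> by simp
    then show "coframe_metric x (E i) (E j) = (if i = j then 1 else 0)"
      using dual_frame_orthonormal [OF K] ij by (simp add: orthonormal_frame_def)
  qed
  from sum_vol_square [OF cx this]
  have "(\<Sum>I\<in>index_lists 7. (cov_mono x ?J (map E I))\<^sup>2) = fact 7" .
  moreover have "cov_mono x ?J (map E I) = d * s ^ 7 * cov_mono y ?J (map K I)" for I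
  proof -
    have "cov_mono y ?J (map (\<lambda>v. s *\<^sub>R v) (map K I)) = cov_mono (\<lambda>i vs. s * y i vs) ?J (map K I)"
      by (rule cov_mono_map) (auto intro: ysc)
    also have "\<dots> = s ^ 7 * cov_mono y ?J (map K I)"
      by (simp only: cov_mono_scale) (simp add: eval_nat_numeral)
    finally have "cov_mono y ?J (map (\<lambda>v. s *\<^sub>R v) (map K I)) = s ^ 7 * cov_mono y ?J (map K I)" .
    moreover have "map E I = map (\<lambda>v. s *\<^sub>R v) (map K I)" by (simp add: E_def)
    ultimately show ?thesis by (simp only: vol mult.assoc)
  qed
  ultimately have "(d * s ^ 7)\<^sup>2 * (\<Sum>I\<in>index_lists 7. (cov_mono y ?J (map K I))\<^sup>2) = fact 7"
    by (simp only: power_mult_distrib sum_distrib_left)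
  then have "(d * s ^ 7)\<^sup>2 = 1"
    unfolding sum_vol_square [OF cy dual_frame_orthonormal [OF K]] by simp
  \<comment> \<open>Positivity of \<open>d\<close> and \<open>s\<close> rules out the value -1, so
    no orientation argument is needed.\<close>
  then have "d * s ^ 7 = 1"
    using \<open>d > 0\<close> \<open>s > 0\<close> by (simp add: power2_eq_1_iff) (smt (verit) mult_pos_pos zero_less_power)
  then have "s ^ 9 = 1"
    by (simp add: s(1) [symmetric] eval_nat_numeral ac_simps)
  then have "s = 1"
    using \<open>s > 0\<close> power_eq_1_iff [of s 9] by simp
  then have "d = 1" using s(1) by simp
  then show ?thesis using metric vol by (auto simp: fun_eq_iff simp del: cov_mono_Nil)
qed

lemma g2_metric_adapted: "adapted x f \<Longrightarrow> g2_metric f = coframe_metric x"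
  unfolding g2_metric_def coframe_metric_def [symmetric]
  by (rule the_equality) (use adapted_unique in blast)+

lemma g2_vol_adapted: "adapted x f \<Longrightarrow> g2_vol f = cov_mono x [1,2,3,4,5,6,7]"
  unfolding g2_vol_def by (rule the_equality) (use adapted_unique in blast)+

section \<open>Invariant forms and the exterior derivative\<close>

lemma frechet_derivative_eqI: "(f has_derivative f') (at x) \<Longrightarrow> frechet_derivative f (at x) = f'"
  using frechet_derivative_at by metis

text \<open>Needed because the rules for derivatives of sums and products hold only at points of
  \<open>S\<close>; elsewhere the functions may fail to be differentiable. Openness makes the
  derivative depend on values in \<open>S\<close> only.\<close>

lemma Ck_on_cong:
  assumes "open S" "\<And>x. x \<in> S \<Longrightarrow> f x = g x" "Ck_on k S f"
  shows "Ck_on k S g"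
  using assms(2,3)
proof (induction k arbitrary: f g)
  case 0
  then show ?case by (simp cong: continuous_on_cong)
next
  case (Suc k)
  have diff: "f differentiable at x" if "x \<in> S" for x
    using Suc.prems(2) that \<open>open S\<close> by (simp add: differentiable_on_eq_differentiable_at)
  have "g differentiable_on S"
    using Suc.prems by (auto simp: differentiable_on_def intro: differentiable_transform_within [of _ _ _ 1])
  moreover have "Ck_on k S (\<lambda>x. frechet_derivative g (at x) b)" for b
  proof (rule Suc.IH)
    show "Ck_on k S (\<lambda>x. frechet_derivative f (at x) b)" using Suc.prems(2) by simp
    show "frechet_derivative f (at x) b = frechet_derivative g (at x) b" if "x \<in> S" for x
      using frechet_derivative_transform_within_open [OF diff \<open>open S\<close>] Suc.prems(1) that by metis
  qed
  ultimately show ?case by simp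
qed

lemma Ck_on_SucD: "Ck_on (Suc k) S f \<Longrightarrow> Ck_on k S f"
proof (induction k arbitrary: f)
  case (Suc k)
  then show ?case by (metis Ck_on.simps(2))
qed (simp add: differentiable_imp_continuous_on)

lemma Ck_on_const: "Ck_on k S (\<lambda>x. a)"
  by (induction k arbitrary: a) simp_all

lemma Ck_on_add:
  assumes "open S" "Ck_on k S f" "Ck_on k S g"
  shows "Ck_on k S (\<lambda>x. f x + g x)"
  using assms(2,3)
proof (induction k arbitrary: f g)
  case (Suc k)
  have diff: "f differentiable at x" "g differentiable at x" if "x \<in> S" for x
    using Suc.prems that \<open>open S\<close> by (simp_all add: differentiable_on_eq_differentiable_at)
  have "Ck_on k S (\<lambda>x. frechet_derivative (\<lambda>x. f x + g x) (at x) b)" for b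
  proof (rule Ck_on_cong [OF \<open>open S\<close>])
    show "Ck_on k S (\<lambda>x. frechet_derivative f (at x) b + frechet_derivative g (at x) b)"
      using Suc by simp
    show "frechet_derivative f (at x) b + frechet_derivative g (at x) b
        = frechet_derivative (\<lambda>x. f x + g x) (at x) b" if "x \<in> S" for x
      using diff [OF that] frechet_derivative_eqI [OF has_derivative_add,
          of f "frechet_derivative f (at x)" x g "frechet_derivative g (at x)"]
      by (simp add: frechet_derivative_works)
  qed
  then show ?case using Suc.prems by simp
qed (auto intro: continuous_intros)

text \<open>The product rule mixes the functions with their derivatives, so the induction also uses
  both functions at the lower order, supplied by \<open>Ck_on_SucD\<close>.\<close>

lemma Ck_on_mult:
  fixes f g :: "'a::euclidean_space \<Rightarrow> real"
  assumes "open S" "Ck_on k S f" "Ck_on k S g"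
  shows "Ck_on k S (\<lambda>x. f x * g x)"
  using assms(2,3)
proof (induction k arbitrary: f g)
  case (Suc k)
  have diff: "f differentiable at x" "g differentiable at x" if "x \<in> S" for x
    using Suc.prems that \<open>open S\<close> by (simp_all add: differentiable_on_eq_differentiable_at)
  have "Ck_on k S (\<lambda>x. frechet_derivative (\<lambda>x. f x * g x) (at x) b)" for b
  proof (rule Ck_on_cong [OF \<open>open S\<close>])
    show "Ck_on k S (\<lambda>x. f x * frechet_derivative g (at x) b + frechet_derivative f (at x) b * g x)"
      using Suc Ck_on_SucD [OF Suc.prems(1)] Ck_on_SucD [OF Suc.prems(2)]
      by (intro Ck_on_add [OF \<open>open S\<close>] Suc.IH) simp_all
    show "f x * frechet_derivative g (at x) b + frechet_derivative f (at x) b * g x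
        = frechet_derivative (\<lambda>x. f x * g x) (at x) b" if "x \<in> S" for x
      using diff [OF that] frechet_derivative_eqI [OF has_derivative_mult,
          of f "frechet_derivative f (at x)" x g "frechet_derivative g (at x)"]
      by (simp add: frechet_derivative_works)
  qed
  then show ?case using Suc.prems by (simp add: differentiable_on_mult)
qed (auto intro: continuous_intros)

lemma smooth_on_const: "smooth_on S (\<lambda>x. a)"
  by (simp add: smooth_on_def Ck_on_const)

lemma smooth_on_add:
  "open S \<Longrightarrow> smooth_on S f \<Longrightarrow> smooth_on S g \<Longrightarrow> smooth_on S (\<lambda>x. f x + g x)"
  by (simp add: smooth_on_def Ck_on_add)

lemma smooth_on_mult:
  fixes f g :: "'a::euclidean_space \<Rightarrow> real"
  shows "open S \<Longrightarrow> smooth_on S f \<Longrightarrow> smooth_on S g \<Longrightarrow> smooth_on S (\<lambda>x. f x * g x)"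
  by (simp add: smooth_on_def Ck_on_mult)

lemma smooth_on_sum:
  "open S \<Longrightarrow> (\<And>i. i \<in> I \<Longrightarrow> smooth_on S (f i)) \<Longrightarrow> smooth_on S (\<lambda>x. \<Sum>i\<in>I. f i x)"
  by (induction I rule: infinite_finite_induct) (simp_all add: smooth_on_const smooth_on_add)

lemma smooth_on_differentiable: "open S \<Longrightarrow> smooth_on S f \<Longrightarrow> x \<in> S \<Longrightarrow> f differentiable at x"
  unfolding smooth_on_def by (metis Ck_on.simps(2) differentiable_on_eq_differentiable_at)

lemma smooth_on_cov_mono:
  assumes "open S" "\<And>i v. i \<in> set I \<Longrightarrow> smooth_on S (\<lambda>z. x z i [v])"
  shows "smooth_on S (\<lambda>z. cov_mono (x z) I vs)"
  using assms(2)
proof (induction I arbitrary: vs)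
  case (Cons i I)
  then show ?case
    unfolding cov_mono_Cons wedge1_def
    by (intro smooth_on_sum smooth_on_mult smooth_on_const \<open>open S\<close>) simp_all
qed (simp add: smooth_on_const)

lemma smooth_on_lincomb:
  assumes "open S" "\<And>a I i v. (a, I) \<in> set ts \<Longrightarrow> i \<in> set I \<Longrightarrow> smooth_on S (\<lambda>z. x z i [v])"
  shows "smooth_on S (\<lambda>z. lincomb (x z) ts vs)"
  using assms(2)
proof (induction ts)
  case (Cons t ts)
  obtain a I where t: "t = (a, I)" by force
  have "smooth_on S (\<lambda>z. cov_mono (x z) I vs)"
    by (rule smooth_on_cov_mono [OF \<open>open S\<close>], rule Cons.prems) (auto simp: t)
  moreover have "smooth_on S (\<lambda>z. lincomb (x z) ts vs)"
    by (rule Cons.IH, rule Cons.prems) auto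
  ultimately show ?case
    unfolding t lincomb_Cons by (intro smooth_on_add smooth_on_mult smooth_on_const \<open>open S\<close>)
qed (simp add: smooth_on_const)

section \<open>Combinations of 1-forms as smooth and invariant forms\<close>

lemma chart_facts:
  assumes "smooth_atlas T A" "c \<in> A"
  shows "fst c \<subseteq> topspace T" "open (snd c ` fst c)" "inj_on (snd c) (fst c)"
proof -
  have c: "openin T (fst c)" "open (snd c ` fst c)"
    "homeomorphic_map (subtopology T (fst c)) (top_of_set (snd c ` fst c)) (snd c)"
    using assms by (auto simp: smooth_atlas_def)
  show sub: "fst c \<subseteq> topspace T" using c(1) by (rule openin_subset)
  show "open (snd c ` fst c)" by (rule c(2))
  show "inj_on (snd c) (fst c)"
    using homeomorphic_imp_injective_map [OF c(3)] sub by (simp add: Int_absorb1)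
qed

lemma chart_inv_chart:
  assumes "smooth_atlas T A" "c \<in> A" "p \<in> fst c"
  shows "chart_inv c (snd c p) = p"
  unfolding chart_inv_def by (rule inv_into_f_f [OF chart_facts(3) [OF assms(1,2)] assms(3)])

lemma chart_inv_in: "z \<in> snd c ` fst c \<Longrightarrow> chart_inv c z \<in> fst c"
  unfolding chart_inv_def by (rule inv_into_into)

text \<open>The components are polynomials in those of the 1-forms, and the transformation law is
  \<open>lincomb_map\<close> for the differential of the chart change. The degree \<open>k\<close>
  is free, since monomials of another length vanish.\<close>

lemma is_form_lincomb:
  assumes A: "smooth_atlas T A"
    and e: "\<And>a I i. (a, I) \<in> set ts \<Longrightarrow> i \<in> set I \<Longrightarrow> is_form A (topspace T) 1 (e i)"
  shows "is_form A (topspace T) k (form_lincomb e ts)"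
  unfolding is_form_def form_lincomb_def
proof (intro conjI ballI allI impI)
  fix c p assume cp: "c \<in> A" "p \<in> fst c \<inter> topspace T"
  show "is_covector k (lincomb (\<lambda>i. e i c p) ts)"
  proof (rule is_covector_lincomb)
    fix a I i assume "(a, I) \<in> set ts" "i \<in> set I"
    from e [OF this] show "is_covector 1 (e i c p)" using cp by (simp add: is_form_def)
  qed
next
  fix c and vs :: "vec list" assume c: "c \<in> A"
  have [simp]: "fst c \<inter> topspace T = fst c" using chart_facts(1) [OF A c] by auto
  have "smooth_on (snd c ` fst c) (\<lambda>z. lincomb (\<lambda>i. e i c (chart_inv c z)) ts vs)"
  proof (rule smooth_on_lincomb [OF chart_facts(2) [OF A c]])
    fix a I i v assume "(a, I) \<in> set ts" "i \<in> set I"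
    from e [OF this] c
    have "\<forall>vs. length vs = 1 \<longrightarrow> smooth_on (snd c ` (fst c \<inter> topspace T)) (\<lambda>z. e i c (chart_inv c z) vs)"
      unfolding is_form_def by blast
    then show "smooth_on (snd c ` fst c) (\<lambda>z. e i c (chart_inv c z) [v])" by simp
  qed
  then show "smooth_on (snd c ` (fst c \<inter> topspace T)) (\<lambda>z. lincomb (\<lambda>i. e i c (chart_inv c z)) ts vs)"
    by simp
next
  fix c c' p and vs :: "vec list"
  assume cp: "c \<in> A" "c' \<in> A" "p \<in> fst c \<inter> fst c' \<inter> topspace T"
  show "lincomb (\<lambda>i. e i c p) ts vs
      = lincomb (\<lambda>i. e i c' p) ts (map (chart_diff c c' (\<lambda>q. q) p) vs)"
  proof (rule lincomb_map [symmetric])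
    fix a I i v assume "(a, I) \<in> set ts" "i \<in> set I"
    from e [OF this] cp
    have "\<forall>vs. length vs = 1 \<longrightarrow> e i c p vs = e i c' p (map (chart_diff c c' (\<lambda>q. q) p) vs)"
      unfolding is_form_def by blast
    from this [rule_format, of "[v]"]
    show "e i c' p [chart_diff c c' (\<lambda>q. q) p v] = e i c p [v]" by simp
  qed
qed

lemma left_invariant_lincomb:
  assumes e: "\<And>a I i. (a, I) \<in> set ts \<Longrightarrow> i \<in> set I \<Longrightarrow> left_invariant G A 1 (e i)"
  shows "left_invariant G A k (form_lincomb e ts)"
  unfolding left_invariant_def form_lincomb_def
proof (intro ballI impI allI)
  fix a c c' p and vs :: "vec list"
  assume *: "a \<in> carrier G" "c \<in> A" "c' \<in> A" "p \<in> fst c" "a \<otimes>\<^bsub>G\<^esub> p \<in> fst c'"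
  show "lincomb (\<lambda>i. e i c' (a \<otimes>\<^bsub>G\<^esub> p)) ts (map (chart_diff c c' (\<lambda>q. a \<otimes>\<^bsub>G\<^esub> q) p) vs)
      = lincomb (\<lambda>i. e i c p) ts vs"
  proof (rule lincomb_map)
    fix b I i v assume "(b, I) \<in> set ts" "i \<in> set I"
    from e [OF this] *
    have "\<forall>vs. length vs = 1 \<longrightarrow>
        e i c' (a \<otimes>\<^bsub>G\<^esub> p) (map (chart_diff c c' (\<lambda>q. a \<otimes>\<^bsub>G\<^esub> q) p) vs) = e i c p vs"
      unfolding left_invariant_def by blast
    from this [rule_format, of "[v]"]
    show "e i c' (a \<otimes>\<^bsub>G\<^esub> p) [chart_diff c c' (\<lambda>q. a \<otimes>\<^bsub>G\<^esub> q) p v] = e i c p [v]" by simp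
  qed
qed

section \<open>Exterior derivative from structure equations\<close>

lemma ext_d_altsum:
  "ext_d \<omega> c p = altsum (\<lambda>u us. frechet_derivative (\<lambda>z. \<omega> c (chart_inv c z) us) (at (snd c p)) u)"
  by (simp add: ext_d_def altsum_def fun_eq_iff)

lemma altsum_has_derivative:
  assumes "\<And>u us. ((\<lambda>z. h z u us) has_derivative h' u us) (at q)"
  shows "((\<lambda>z. altsum (h z) vs) has_derivative (\<lambda>w. altsum (\<lambda>u us. h' u us w) vs)) (at q)"
  using assms
proof (induction vs arbitrary: h h')
  case (Cons v vs)
  have "((\<lambda>z. altsum (\<lambda>u us. h z u (v # us)) vs) has_derivative
      (\<lambda>w. altsum (\<lambda>u us. h' u (v # us) w) vs)) (at q)"
    by (rule Cons.IH) (rule Cons.prems)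
  then show ?case using Cons.prems by (auto intro: has_derivative_diff)
qed simp

text \<open>The Leibniz rule, where \<open>D i\<close> stands for the exterior derivative of the
  i-th 1-form.\<close>

primrec d_mono :: "(nat \<Rightarrow> terms) \<Rightarrow> nat list \<Rightarrow> terms" where
  "d_mono D [] = []"
| "d_mono D (i # I) = wedge_terms (D i) [(1, I)] @ map (\<lambda>(a, J). (- a, i # J)) (d_mono D I)"

definition d_terms :: "(nat \<Rightarrow> terms) \<Rightarrow> terms \<Rightarrow> terms" where
  "d_terms D ts = concat (map (\<lambda>(a, I). a \<cdot>\<^sub>t d_mono D I) ts)"

text \<open>Stated for a general coframe so that the same results apply to the given basis and to
  the rescaled coframe at each time.\<close>

locale invariant_coframe =
  fixes G :: "'g monoid" and T :: "'g topology" and A :: "('g, vec) chart set"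
    and x :: "nat \<Rightarrow> 'g form" and D :: "nat \<Rightarrow> terms"
  assumes atlas: "smooth_atlas T A"
    and form: "\<And>i. i \<in> {1..7} \<Longrightarrow> is_form A (topspace T) 1 (x i)"
    and invariant: "\<And>i. i \<in> {1..7} \<Longrightarrow> left_invariant G A 1 (x i)"
    and coframe: "\<And>c p. c \<in> A \<Longrightarrow> p \<in> fst c \<Longrightarrow> is_coframe (\<lambda>i. x i c p)"
    and equations: "\<And>i. i \<in> {1..7} \<Longrightarrow> form_eq A 2 (ext_d (x i)) (form_lincomb x (D i))"
    and two_forms: "\<And>i a I. i \<in> {1..7} \<Longrightarrow> (a, I) \<in> set (D i) \<Longrightarrow> length I = 2 \<and> set I \<subseteq> {1..7}"
begin

lemma differentiable:
  assumes "c \<in> A" "p \<in> fst c" "i \<in> {1..7}"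
  shows "(\<lambda>z. x i c (chart_inv c z) [v]) differentiable at (snd c p)"
proof -
  have "\<forall>vs. length vs = 1 \<longrightarrow> smooth_on (snd c ` (fst c \<inter> topspace T)) (\<lambda>z. x i c (chart_inv c z) vs)"
    using form [OF assms(3)] assms(1) unfolding is_form_def by blast
  moreover have "fst c \<inter> topspace T = fst c" using chart_facts(1) [OF atlas assms(1)] by auto
  ultimately have "smooth_on (snd c ` fst c) (\<lambda>z. x i c (chart_inv c z) [v])" by simp
  then show ?thesis
    using smooth_on_differentiable [OF chart_facts(2) [OF atlas assms(1)]] assms(2) by blast
qed

lemma differentiable_cov_mono:
  assumes "c \<in> A" "p \<in> fst c" "set I \<subseteq> {1..7}"
  shows "(\<lambda>z. cov_mono (\<lambda>i. x i c (chart_inv c z)) I vs) differentiable at (snd c p)"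
  using assms(3)
proof (induction I arbitrary: vs)
  case (Cons i I)
  have "i \<in> {1..7}" "set I \<subseteq> {1..7}" using Cons.prems by auto
  then show ?case
    unfolding cov_mono_Cons wedge1_def
    by (intro differentiable_sum ballI differentiable_mult differentiable_const Cons.IH
        differentiable [OF assms(1,2)]) auto
qed simp

lemma differentiable_lincomb:
  assumes "c \<in> A" "p \<in> fst c" "\<And>a I. (a, I) \<in> set ts \<Longrightarrow> set I \<subseteq> {1..7}"
  shows "(\<lambda>z. lincomb (\<lambda>i. x i c (chart_inv c z)) ts vs) differentiable at (snd c p)"
  using assms(3)
proof (induction ts)
  case (Cons t ts)
  obtain a I where t: "t = (a, I)" by force
  have "set I \<subseteq> {1..7}" using Cons.prems [of a I] t by simp
  moreover have "(\<lambda>z. lincomb (\<lambda>i. x i c (chart_inv c z)) ts vs) differentiable at (snd c p)"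
    by (rule Cons.IH, rule Cons.prems) auto
  ultimately show ?case
    unfolding t lincomb_Cons
    by (intro differentiable_add differentiable_mult differentiable_const
        differentiable_cov_mono assms(1,2))
qed simp

text \<open>In a chart the wedge is differentiated by the product rule. Derivatives falling on the
  tail give the second Leibniz term; those falling on the first factor form a \<open>wedge2\<close>
  with its derivative matrix.\<close>

lemma ext_d_cov_mono:
  assumes cp: "c \<in> A" "p \<in> fst c" and "set I \<subseteq> {1..7}"
  shows "altsum (\<lambda>u us. frechet_derivative
        (\<lambda>z. cov_mono (\<lambda>i. x i c (chart_inv c z)) I us) (at (snd c p)) u) vs
    = lincomb (\<lambda>i. x i c p) (d_mono D I) vs"
  using assms(3)
proof (induction I arbitrary: vs)
  case Nil
  then show ?case by (simp add: frechet_derivative_const)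
next
  case (Cons i I)
  let ?q = "snd c p"
  have i: "i \<in> {1..7}" and I: "set I \<subseteq> {1..7}" using Cons.prems by auto
  have [simp]: "chart_inv c ?q = p" by (rule chart_inv_chart [OF atlas cp])
  define \<alpha> where "\<alpha> = (\<lambda>z. x i c (chart_inv c z))"
  define \<beta> where "\<beta> = (\<lambda>z. cov_mono (\<lambda>i. x i c (chart_inv c z)) I)"
  define \<alpha>' where "\<alpha>' = (\<lambda>u w. frechet_derivative (\<lambda>z. \<alpha> z [w]) (at ?q) u)"
  define \<beta>' where "\<beta>' = (\<lambda>u us. frechet_derivative (\<lambda>z. \<beta> z us) (at ?q) u)"
  have d\<alpha>: "((\<lambda>z. \<alpha> z [w]) has_derivative (\<lambda>u. \<alpha>' u w)) (at ?q)" for w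
    using differentiable [OF cp i] unfolding \<alpha>'_def \<alpha>_def by (simp add: frechet_derivative_works)
  have d\<beta>: "((\<lambda>z. \<beta> z us) has_derivative (\<lambda>u. \<beta>' u us)) (at ?q)" for us
    using differentiable_cov_mono [OF cp I] unfolding \<beta>'_def \<beta>_def
    by (simp add: frechet_derivative_works)
  have "frechet_derivative (\<lambda>z. wedge1 (\<alpha> z) (\<beta> z) us) (at ?q) u
      = altsum (\<lambda>w ws. \<alpha> ?q [w] * \<beta>' u ws + \<alpha>' u w * \<beta> ?q ws) us" for u us
    unfolding wedge1_altsum
    by (subst frechet_derivative_eqI [OF altsum_has_derivative [OF has_derivative_mult [OF d\<alpha> d\<beta>]]])
      (rule refl)
  then have "altsum (\<lambda>u us. frechet_derivative (\<lambda>z. wedge1 (\<alpha> z) (\<beta> z) us) (at ?q) u) vs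
      = altsum (\<lambda>u. altsum (\<lambda>w ws. \<alpha> ?q [w] * \<beta>' u ws)) vs + wedge2 \<alpha>' (\<beta> ?q) vs"
    by (simp add: wedge2_def altsum_fun)
  \<comment> \<open>The direction of differentiation is moved behind the slot of the 1-form; this
    exchange produces the minus sign of the Leibniz rule.\<close>
  also have "altsum (\<lambda>u. altsum (\<lambda>w ws. \<alpha> ?q [w] * \<beta>' u ws)) vs
      = - wedge1 (\<alpha> ?q) (altsum (\<lambda>u us. \<beta>' u us)) vs"
    using altsum_swap [of "\<lambda>w u ws. \<alpha> ?q [w] * \<beta>' u ws" vs] by (simp add: wedge1_altsum altsum_fun)
  also have "altsum (\<lambda>u us. \<beta>' u us) = lincomb (\<lambda>i. x i c p) (d_mono D I)"
    using Cons.IH [OF I] by (simp add: fun_eq_iff \<beta>'_def \<beta>_def)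
  also have "wedge2 \<alpha>' (\<beta> ?q) vs = lincomb (\<lambda>i. x i c p) (wedge_terms (D i) [(1, I)]) vs"
  proof -
    \<comment> \<open>On a pair of vectors \<open>ext_d\<close> is the antisymmetrised derivative
      matrix, so the structure equation determines exactly the part that \<open>wedge2\<close>
      sees.\<close>
    have "\<alpha>' u w - \<alpha>' w u = lincomb (\<lambda>i. x i c p) (D i) [u, w]" for u w
    proof -
      have "ext_d (x i) c p [u, w] = \<alpha>' u w - \<alpha>' w u"
        by (simp add: ext_d_altsum \<alpha>'_def \<alpha>_def)
      moreover have "ext_d (x i) c p [u, w] = lincomb (\<lambda>i. x i c p) (D i) [u, w]"
        using equations [OF i] cp by (simp add: form_eq_def form_lincomb_def)
      ultimately show ?thesis by simp
    qed
    moreover have "\<beta> ?q = lincomb (\<lambda>i. x i c p) [(1, I)]"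
      by (simp add: \<beta>_def lincomb_Cons fun_eq_iff)
    ultimately have "2 * wedge2 \<alpha>' (\<beta> ?q) vs
        = wedge2 (\<lambda>u w. lincomb (\<lambda>i. x i c p) (D i) [u, w]) (lincomb (\<lambda>i. x i c p) [(1, I)]) vs"
      by (simp only: wedge2_antisym)
    then show ?thesis
      using wedge2_lincomb [OF two_forms [OF i, THEN conjunct1], where x = "\<lambda>i. x i c p"] by simp
  qed
  finally show ?case
    using lincomb_Cons_index [of "\<lambda>i. x i c p" "-1" i "d_mono D I" vs]
    by (simp add: \<alpha>_def \<beta>_def cov_mono_Cons lincomb_append)
qed

lemma ext_d_lincomb:
  assumes cp: "c \<in> A" "p \<in> fst c" and "\<And>a I. (a, I) \<in> set ts \<Longrightarrow> set I \<subseteq> {1..7}"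
  shows "ext_d (form_lincomb x ts) c p vs = form_lincomb x (d_terms D ts) c p vs"
  using assms(3)
proof (induction ts)
  case Nil
  then show ?case by (simp add: ext_d_altsum form_lincomb_def d_terms_def frechet_derivative_const)
next
  case (Cons t ts)
  let ?q = "snd c p"
  obtain a I where t: "t = (a, I)" by force
  have I: "set I \<subseteq> {1..7}" using Cons.prems [of a I] t by simp
  have ts: "\<And>a I. (a, I) \<in> set ts \<Longrightarrow> set I \<subseteq> {1..7}" using Cons.prems by auto
  have "frechet_derivative (\<lambda>z. lincomb (\<lambda>i. x i c (chart_inv c z)) (t # ts) us) (at ?q) u
      = a * frechet_derivative (\<lambda>z. cov_mono (\<lambda>i. x i c (chart_inv c z)) I us) (at ?q) u
      + frechet_derivative (\<lambda>z. lincomb (\<lambda>i. x i c (chart_inv c z)) ts us) (at ?q) u" for u us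
    unfolding t lincomb_Cons
    using frechet_derivative_eqI [OF has_derivative_add [OF has_derivative_mult_right
          [OF differentiable_cov_mono [OF cp I, unfolded frechet_derivative_works]]
          differentiable_lincomb [OF cp ts, unfolded frechet_derivative_works]]]
    by simp
  then have "ext_d (form_lincomb x (t # ts)) c p vs
      = a * lincomb (\<lambda>i. x i c p) (d_mono D I) vs + ext_d (form_lincomb x ts) c p vs"
    using ext_d_cov_mono [OF cp I]
    by (simp add: ext_d_altsum form_lincomb_def altsum_add altsum_mult)
  then show ?case
    using Cons.IH [OF ts] by (simp add: t form_lincomb_def d_terms_def lincomb_append lincomb_scale)
qed

end

section \<open>The Laplacian of the standard 4-form\<close>

lemma lincomb_sort_eqI:
  "lincomb y (sort_terms ts) vs = lincomb y (sort_terms us) vs \<Longrightarrow> lincomb y ts vs = lincomb y us vs"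
  by (simp only: lincomb_sort)

text \<open>With \<open>\<phi> = \<omega> \<and> x\<^sup>7 + Re \<Omega>\<close> these are \<open>Im \<Omega> = \<star>(x\<^sup>7 \<and> \<phi>)\<close> and \<open>\<omega> = \<star>(x\<^sup>7 \<and> \<star>\<phi>)\<close>.\<close>

definition im_terms :: terms where
  "im_terms = [(1, [1,3,6]), (1, [1,4,5]), (1, [2,3,5]), (-1, [2,4,6])]"

definition omega_terms :: terms where
  "omega_terms = [(1, [1,2]), (1, [3,4]), (1, [5,6])]"

lemmas terms_eval = sort_terms_def wedge_terms_def star_terms_def contract_index_terms_def
  scale_terms_def d_terms_def g2_terms_def psi_terms_def im_terms_def omega_terms_def

lemma star_g2_terms: "lincomb y (star_terms g2_terms) vs = lincomb y psi_terms vs"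
  by (rule lincomb_sort_eqI) (simp add: terms_eval lincomb_Cons)

lemma star_psi_terms: "lincomb y (star_terms psi_terms) vs = lincomb y g2_terms vs"
  by (rule lincomb_sort_eqI) (simp add: terms_eval lincomb_Cons)

lemma scale_terms_scale: "r \<cdot>\<^sub>t s \<cdot>\<^sub>t ts = (r * s) \<cdot>\<^sub>t ts"
  by (simp add: scale_terms_def split_def o_def mult.assoc)

lemma scale_terms_concat: "r \<cdot>\<^sub>t concat tss = concat (map (\<lambda>ts. r \<cdot>\<^sub>t ts) tss)"
  by (simp add: scale_terms_def map_concat)

lemma star_terms_scale: "star_terms (r \<cdot>\<^sub>t ts) = r \<cdot>\<^sub>t star_terms ts"
  by (simp add: star_terms_def scale_terms_concat scale_terms_def [of r ts] o_def split_def scale_terms_scale)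

lemma d_terms_scale: "d_terms D (r \<cdot>\<^sub>t ts) = r \<cdot>\<^sub>t d_terms D ts"
  by (simp add: d_terms_def scale_terms_concat scale_terms_def [of r ts] o_def split_def scale_terms_scale)

lemma star_tau_g2_terms:
  "lincomb y (star_terms (r \<cdot>\<^sub>t wedge_terms [(1, [7])] g2_terms)) vs = lincomb y (r \<cdot>\<^sub>t im_terms) vs"
  by (rule lincomb_sort_eqI) (simp add: terms_eval lincomb_Cons)

lemma star_tau_psi_terms:
  "lincomb y (star_terms (r \<cdot>\<^sub>t wedge_terms [(1, [7])] psi_terms)) vs = lincomb y (r \<cdot>\<^sub>t omega_terms) vs"
  by (rule lincomb_sort_eqI) (simp add: terms_eval lincomb_Cons)

lemma terms_degree:
  "(a, I) \<in> set g2_terms \<Longrightarrow> length I = 3 \<and> set I \<subseteq> {1..7}"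
  "(a, I) \<in> set psi_terms \<Longrightarrow> length I = 4 \<and> set I \<subseteq> {1..7}"
  "(a, I) \<in> set (r \<cdot>\<^sub>t im_terms) \<Longrightarrow> length I = 3 \<and> set I \<subseteq> {1..7}"
  "(a, I) \<in> set (r \<cdot>\<^sub>t omega_terms) \<Longrightarrow> length I = 2 \<and> set I \<subseteq> {1..7}"
  "(a, I) \<in> set (r \<cdot>\<^sub>t wedge_terms [(1, [7])] g2_terms) \<Longrightarrow> length I = 4 \<and> set I \<subseteq> {1..7}"
  "(a, I) \<in> set (r \<cdot>\<^sub>t wedge_terms [(1, [7])] psi_terms) \<Longrightarrow> length I = 5 \<and> set I \<subseteq> {1..7}"
  by (auto simp: terms_eval)

lemma wedge1_lincomb:
  "wedge1 (lincomb y [(r, [i])]) (lincomb y ts) vs = r * lincomb y (wedge_terms [(1, [i])] ts) vs"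
proof -
  have "wedge1 (lincomb y [(r, [i])]) (lincomb y ts) vs = r * wedge1 (y i) (lincomb y ts) vs"
    by (simp add: wedge1_altsum lincomb_Cons cov_mono_Cons unit_covector_def altsum_mult mult.assoc)
  then show ?thesis
    using lincomb_Cons_index [of y 1 i ts vs] by (simp add: wedge_terms_def)
qed

lemma d_mono_degree:
  assumes "\<And>i a J. i \<in> {1..7} \<Longrightarrow> (a, J) \<in> set (D i) \<Longrightarrow> length J = 2 \<and> set J \<subseteq> {1..7}"
    and "set I \<subseteq> {1..7}" "(a, J) \<in> set (d_mono D I)"
  shows "length J = Suc (length I) \<and> set J \<subseteq> {1..7}"
  using assms(2,3)
proof (induction I arbitrary: a J)
  case (Cons i I)
  have i: "i \<in> {1..7}" and I: "set I \<subseteq> {1..7}" using Cons.prems(1) by auto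
  from Cons.prems(2) consider
      b K where "(b, K) \<in> set (D i)" "J = K @ I"
    | b K where "(b, K) \<in> set (d_mono D I)" "J = i # K"
    by (auto simp: wedge_terms_def)
  then show ?case
  proof cases
    case 1
    then show ?thesis using assms(1) [OF i 1(1)] I by simp
  next
    case 2
    then show ?thesis using Cons.IH [OF I 2(1)] i by simp
  qed
qed simp

text \<open>The star needs homogeneous terms. The derivative of omega is not expanded for a general
  \<open>D\<close>, so its degree has to come from the Leibniz rule.\<close>

lemma d_terms_degree:
  assumes "\<And>i a J. i \<in> {1..7} \<Longrightarrow> (a, J) \<in> set (D i) \<Longrightarrow> length J = 2 \<and> set J \<subseteq> {1..7}"
    and "\<And>a I. (a, I) \<in> set ts \<Longrightarrow> length I = k \<and> set I \<subseteq> {1..7}"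
    and "(a, J) \<in> set (d_terms D ts)"
  shows "length J = Suc k \<and> set J \<subseteq> {1..7}"
proof -
  obtain b I c where "(b, I) \<in> set ts" "(c, J) \<in> set (d_mono D I)"
    using assms(3) by (auto simp: d_terms_def scale_terms_def)
  moreover from this have "length I = k" "set I \<subseteq> {1..7}" using assms(2) by auto
  ultimately show ?thesis using d_mono_degree [OF assms(1), where I = I and a = c and J = J] by simp
qed

lemma form_eq_trans: "form_eq A k \<alpha> \<beta> \<Longrightarrow> form_eq A k \<beta> \<gamma> \<Longrightarrow> form_eq A k \<alpha> \<gamma>"
  by (simp add: form_eq_def)

lemma form_eq_lincombI:
  "(\<And>y vs. lincomb y ts vs = lincomb y us vs) \<Longrightarrow> form_eq A k (form_lincomb x ts) (form_lincomb x us)"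
  by (simp add: form_eq_def form_lincomb_def)

context invariant_coframe
begin

text \<open>Form equality holds on whole chart domains, whose images are open, so it passes to
  derivatives at each point.\<close>

lemma ext_d_form_eq:
  assumes \<omega>: "form_eq A k \<omega> (form_lincomb x ts)"
    and ts: "\<And>a I. (a, I) \<in> set ts \<Longrightarrow> set I \<subseteq> {1..7}"
  shows "form_eq A (Suc k) (ext_d \<omega>) (form_lincomb x (d_terms D ts))"
  unfolding form_eq_def
proof (intro ballI allI impI)
  fix c p and vs :: "vec list"
  assume cp: "c \<in> A" "p \<in> fst c" and vs: "length vs = Suc k"
  have "ext_d \<omega> c p vs = ext_d (form_lincomb x ts) c p vs"
    unfolding ext_d_altsum
  proof (rule altsum_cong)
    fix u :: vec and us :: "vec list"
    assume us: "Suc (length us) = length vs"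
    have "frechet_derivative (\<lambda>z. form_lincomb x ts c (chart_inv c z) us) (at (snd c p))
        = frechet_derivative (\<lambda>z. \<omega> c (chart_inv c z) us) (at (snd c p))"
    proof (rule frechet_derivative_transform_within_open)
      show "(\<lambda>z. form_lincomb x ts c (chart_inv c z) us) differentiable at (snd c p)"
        unfolding form_lincomb_def by (rule differentiable_lincomb [OF cp ts])
      show "open (snd c ` fst c)" by (rule chart_facts(2) [OF atlas cp(1)])
      show "snd c p \<in> snd c ` fst c" using cp by blast
      show "form_lincomb x ts c (chart_inv c z) us = \<omega> c (chart_inv c z) us"
        if "z \<in> snd c ` fst c" for z
        using \<omega> us vs cp(1) chart_inv_in [OF that] unfolding form_eq_def by simp
    qed
    then show "frechet_derivative (\<lambda>z. \<omega> c (chart_inv c z) us) (at (snd c p)) u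
        = frechet_derivative (\<lambda>z. form_lincomb x ts c (chart_inv c z) us) (at (snd c p)) u"
      by simp
  qed
  then show "ext_d \<omega> c p vs = form_lincomb x (d_terms D ts) c p vs"
    by (simp add: ext_d_lincomb [OF cp ts])
qed

abbreviation phi :: "'g form" where "phi \<equiv> form_lincomb x g2_terms"

lemma adapted_phi: "c \<in> A \<Longrightarrow> p \<in> fst c \<Longrightarrow> adapted (\<lambda>i. x i c p) (phi c p)"
  by (simp add: adapted_def coframe form_lincomb_def)

lemma star_lincomb:
  assumes "form_eq A k \<omega> (form_lincomb x ts)"
    and "\<And>a I. (a, I) \<in> set ts \<Longrightarrow> length I = k \<and> set I \<subseteq> {1..7}"
    and "c \<in> A" "p \<in> fst c"
  shows "star phi k \<omega> c p = lincomb (\<lambda>i. x i c p) (star_terms ts)"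
  unfolding star_def g2_metric_adapted [OF adapted_phi [OF assms(3,4)]]
    g2_vol_adapted [OF adapted_phi [OF assms(3,4)]]
  using assms by (intro hodge_lincomb coframe) (auto simp: form_eq_def form_lincomb_def)

lemma star_form_eq:
  assumes "form_eq A k \<omega> (form_lincomb x ts)"
    and "\<And>a I. (a, I) \<in> set ts \<Longrightarrow> length I = k \<and> set I \<subseteq> {1..7}"
    and "\<And>y vs. lincomb y (star_terms ts) vs = lincomb y us vs"
  shows "form_eq A l (star phi k \<omega>) (form_lincomb x us)"
  using star_lincomb [OF assms(1,2)] assms(3) by (simp add: form_eq_def form_lincomb_def)

lemma star_phi: "form_eq A l (star phi 3 phi) (form_lincomb x psi_terms)"
  by (rule star_form_eq [OF _ terms_degree(1) star_g2_terms]) (simp add: form_eq_def)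

lemma star_star_phi: "form_eq A l (star phi 4 (star phi 3 phi)) phi"
  by (rule star_form_eq [OF star_phi terms_degree(2) star_psi_terms])

lemma g2_structure_phi: "g2_structure T A phi"
  unfolding g2_structure_def
proof (intro conjI ballI)
  show "is_form A (topspace T) 3 phi"
    by (rule is_form_lincomb [OF atlas form]) (use terms_degree(1) in blast)
  show "\<exists>W y. openin T W \<and> q \<in> W \<and> (\<forall>i\<in>{1..7}. is_form A W 1 (y i)) \<and>
      (\<forall>c\<in>A. \<forall>p\<in>fst c \<inter> W. adapted (\<lambda>i. y i c p) (phi c p))" if "q \<in> topspace T" for q
    by (intro exI [of _ "topspace T"] exI [of _ x] conjI ballI form adapted_phi openin_topspace)
      (use that in auto)
qed

lemma left_invariant_phi: "left_invariant G A 3 phi"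
  by (rule left_invariant_lincomb [OF invariant]) (use terms_degree(1) in blast)

end

text \<open>The 1-form \<open>\<mu> x\<^sup>7\<close> is the Lee form, and \<open>\<Delta>\<psi>\<close> is diagonal: its coefficient at \<open>x\<^sup>I\<close> is
  \<open>- \<mu>\<^sup>2 L I\<close> times that of \<open>\<psi>\<close>.\<close>

definition lcp_equations :: "(nat \<Rightarrow> terms) \<Rightarrow> real \<Rightarrow> (nat list \<Rightarrow> real) \<Rightarrow> bool" where
  "lcp_equations D \<mu> L \<longleftrightarrow> (\<forall>y vs.
     lincomb y (d_terms D g2_terms) vs = lincomb y ((3 * \<mu>) \<cdot>\<^sub>t wedge_terms [(1, [7])] g2_terms) vs \<and>
     lincomb y (d_terms D psi_terms) vs = lincomb y ((4 * \<mu>) \<cdot>\<^sub>t wedge_terms [(1, [7])] psi_terms) vs \<and>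
     lincomb y ((3 * \<mu>) \<cdot>\<^sub>t d_terms D im_terms @ (- 4 * \<mu>) \<cdot>\<^sub>t star_terms (d_terms D omega_terms)) vs
       = lincomb y (map (\<lambda>(a, I). (- (L I * \<mu>\<^sup>2 * a), I)) psi_terms) vs)"

context invariant_coframe
begin

text \<open>As star psi = phi, the codifferential of psi is the star of d phi, that is 3 \<mu> Im
  Omega. In degree 5 the codifferential carries a minus sign, and the star of d psi is 4 \<mu>
  omega. Hence the Laplacian is 3 \<mu> d Im Omega minus 4 \<mu> star d omega, the third equation of
  \<open>lcp_equations\<close>.\<close>

lemma
  assumes "lcp_equations D \<mu> L"
  shows lcp_phi: "lcp T A phi"
    and laplacian_star_phi: "form_eq A 4 (laplacian phi 4 (star phi 3 phi))
      (form_lincomb x (map (\<lambda>(a, I). (- (L I * \<mu>\<^sup>2 * a), I)) psi_terms))"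
proof -
  let ?\<psi> = "star phi 3 phi"
  note eqs = assms [unfolded lcp_equations_def, rule_format]
  have d\<phi>: "form_eq A 4 (ext_d phi) (form_lincomb x ((3 * \<mu>) \<cdot>\<^sub>t wedge_terms [(1, [7])] g2_terms))"
  proof (rule form_eq_trans)
    show "form_eq A 4 (ext_d phi) (form_lincomb x (d_terms D g2_terms))"
      using ext_d_form_eq [of 3 phi g2_terms] terms_degree(1) by (simp add: form_eq_def)
  qed (rule form_eq_lincombI, use eqs in blast)
  have d\<psi>: "form_eq A 5 (ext_d ?\<psi>) (form_lincomb x ((4 * \<mu>) \<cdot>\<^sub>t wedge_terms [(1, [7])] psi_terms))"
  proof (rule form_eq_trans)
    show "form_eq A 5 (ext_d ?\<psi>) (form_lincomb x (d_terms D psi_terms))"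
      using ext_d_form_eq [OF star_phi [of 4]] terms_degree(2) by simp
  qed (rule form_eq_lincombI, use eqs in blast)
  show "lcp T A phi"
    unfolding lcp_def
  proof (intro conjI exI)
    let ?\<tau> = "form_lincomb x [(\<mu>, [7])]"
    show "g2_structure T A phi" by (rule g2_structure_phi)
    show "is_form A (topspace T) 1 ?\<tau>"
      by (rule is_form_lincomb [OF atlas form]) auto
    show "form_eq A 4 (ext_d phi) (form_scale 3 (form_wedge1 ?\<tau> phi))"
      using d\<phi> by (simp add: form_eq_def form_lincomb_def form_scale_def form_wedge1_def
          wedge1_lincomb lincomb_scale)
    \<comment> \<open>The wedge with the Lee form takes psi as a function on lists, so equality in a
      single degree is not enough; the free degree in \<open>star_phi\<close> gives equality of
      functions.\<close>
    have "star phi 3 phi c p = lincomb (\<lambda>i. x i c p) psi_terms" if "c \<in> A" "p \<in> fst c" for c p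
      using star_phi that unfolding form_eq_def form_lincomb_def fun_eq_iff by blast
    then show "form_eq A 5 (ext_d ?\<psi>) (form_scale 4 (form_wedge1 ?\<tau> ?\<psi>))"
      using d\<psi> by (simp add: form_eq_def form_lincomb_def form_scale_def form_wedge1_def
          wedge1_lincomb lincomb_scale)
  qed
  have "form_eq A 4 (ext_d (star phi 4 ?\<psi>))
      (form_lincomb x ((3 * \<mu>) \<cdot>\<^sub>t wedge_terms [(1, [7])] g2_terms))"
  proof (rule form_eq_trans)
    show "form_eq A 4 (ext_d (star phi 4 ?\<psi>)) (form_lincomb x (d_terms D g2_terms))"
      using ext_d_form_eq [OF star_star_phi [of 3]] terms_degree(1) by simp
  qed (rule form_eq_lincombI, use eqs in blast)
  from star_form_eq [OF this terms_degree(5) star_tau_g2_terms]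
  have "form_eq A 3 (codiff phi 4 ?\<psi>) (form_lincomb x ((3 * \<mu>) \<cdot>\<^sub>t im_terms))"
    by (simp add: codiff_def form_scale_def form_eq_def)
  from ext_d_form_eq [OF this] have dd: "form_eq A 4 (ext_d (codiff phi 4 ?\<psi>))
      (form_lincomb x ((3 * \<mu>) \<cdot>\<^sub>t d_terms D im_terms))"
    using terms_degree(3) by (simp add: d_terms_scale)
  have "form_eq A 2 (star phi 5 (ext_d ?\<psi>)) (form_lincomb x ((4 * \<mu>) \<cdot>\<^sub>t omega_terms))"
    by (rule star_form_eq [OF d\<psi> terms_degree(6) star_tau_psi_terms])
  from ext_d_form_eq [OF this] have "form_eq A 3 (ext_d (star phi 5 (ext_d ?\<psi>)))
      (form_lincomb x (d_terms D ((4 * \<mu>) \<cdot>\<^sub>t omega_terms)))"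
    using terms_degree(4) by simp
  then have "form_eq A 4 (star phi 3 (ext_d (star phi 5 (ext_d ?\<psi>))))
      (form_lincomb x (star_terms (d_terms D ((4 * \<mu>) \<cdot>\<^sub>t omega_terms))))"
  proof (rule star_form_eq)
    fix a I assume "(a, I) \<in> set (d_terms D ((4 * \<mu>) \<cdot>\<^sub>t omega_terms))"
    then show "length I = 3 \<and> set I \<subseteq> {1..7}"
      using d_terms_degree [OF two_forms terms_degree(4)] by simp
  qed simp
  with dd have "form_eq A 4 (laplacian phi 4 ?\<psi>) (form_lincomb x
      ((3 * \<mu>) \<cdot>\<^sub>t d_terms D im_terms @ (- 4 * \<mu>) \<cdot>\<^sub>t star_terms (d_terms D omega_terms)))"
    by (simp add: form_eq_def form_lincomb_def laplacian_def codiff_def [of _ "Suc _"] codiff_def [of _ 5]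
        form_add_def form_scale_def d_terms_scale star_terms_scale lincomb_append lincomb_scale)
  then show "form_eq A 4 (laplacian phi 4 ?\<psi>)
      (form_lincomb x (map (\<lambda>(a, I). (- (L I * \<mu>\<^sup>2 * a), I)) psi_terms))"
    by (rule form_eq_trans) (rule form_eq_lincombI, use eqs in blast)
qed

end

section \<open>Families with power coefficients\<close>

lemma lincomb_scaled_coframe:
  "lincomb (\<lambda>i. form_lincomb e [(f i, [i])] c p) ts vs
    = lincomb (\<lambda>i. e i c p) (map (\<lambda>(a, I). (a * prod_list (map f I), I)) ts) vs"
proof (induction ts)
  case (Cons t ts)
  obtain a I where t: "t = (a, I)" by force
  have "form_lincomb e [(f i, [i])] c p [v] = f i * e i c p [v]" for i v
    by (simp add: form_lincomb_def lincomb_Cons cov_mono_Cons wedge1_Cons unit_covector_def)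
  \<comment> \<open>The two 1-covectors agree on single vectors only, so \<open>cov_mono_map\<close>
    is applied with the identity map.\<close>
  then have "cov_mono (\<lambda>i. form_lincomb e [(f i, [i])] c p) I (map (\<lambda>v. v) vs)
      = cov_mono (\<lambda>i vs. f i * e i c p vs) I vs"
    by (intro cov_mono_map)
  then show ?case
    using Cons by (simp add: t lincomb_Cons cov_mono_scale)
qed simp

lemma prod_list_powr: "0 < (s::real) \<Longrightarrow> prod_list (map (\<lambda>i. s powr r i) I) = s powr sum_list (map r I)"
  by (induction I) (simp_all add: powr_add)

text \<open>With \<open>s > 0\<close>, the rescaled coframe \<open>s\<^bsup>r i\<^esup> e\<^sup>i\<close> satisfies the structure equations of \<open>des\<close>
  with the parameter \<open>m\<close> replaced by \<open>s\<^bsup>-1/2\<^esup> m\<close>.\<close>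

definition scaling_family :: "(real \<Rightarrow> terms list) \<Rightarrow> (nat \<Rightarrow> real) \<Rightarrow> bool" where
  "scaling_family des r \<longleftrightarrow> (\<forall>i\<in>{1..7}.
     (\<forall>m s. des (s * m) ! (i - 1) = s \<cdot>\<^sub>t (des m ! (i - 1))) \<and>
     (\<forall>m a I. (a, I) \<in> set (des m ! (i - 1)) \<longrightarrow>
        length I = 2 \<and> set I \<subseteq> {1..7} \<and> sum_list (map r I) = r i + 1/2))"

lemma invariant_coframe_structure_equations:
  assumes "smooth_atlas T A" "has_structure_equations G T A e (des m)" "scaling_family des r"
  shows "invariant_coframe G T A e (\<lambda>i. des m ! (i - 1))"
proof
  show "length I = 2 \<and> set I \<subseteq> {1..7}" if "i \<in> {1..7}" "(a, I) \<in> set (des m ! (i - 1))" for i a I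
    using assms(3) that unfolding scaling_family_def by blast
qed (use assms in \<open>simp_all add: has_structure_equations_def\<close>)

text \<open>If I occurs in d e^i, then s^(r i) e^I is s^(r i - sum of r over I) x^I. The weight
  condition makes this exponent -1/2 for every term, and homogeneity of \<open>des\<close> in the
  parameter absorbs the common factor.\<close>

lemma invariant_coframe_scaled:
  assumes e: "invariant_coframe G T A e (\<lambda>i. des m ! (i - 1))" and des: "scaling_family des r"
    and "0 < s"
  shows "invariant_coframe G T A (\<lambda>i. form_lincomb e [(s powr r i, [i])])
    (\<lambda>i. des (s powr (-1/2) * m) ! (i - 1))"
proof -
  interpret e: invariant_coframe G T A e "\<lambda>i. des m ! (i - 1)" by (rule e)
  let ?x = "\<lambda>i. form_lincomb e [(s powr r i, [i])]"
  show ?thesis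
  proof
    show "smooth_atlas T A" by (rule e.atlas)
    fix i :: nat assume i: "i \<in> {1..7}"
    show "is_form A (topspace T) 1 (?x i)"
      by (rule is_form_lincomb [OF e.atlas e.form]) (use i in auto)
    show "left_invariant G A 1 (?x i)"
      by (rule left_invariant_lincomb [OF e.invariant]) (use i in auto)
    show "length I = 2 \<and> set I \<subseteq> {1..7}" if "(a, I) \<in> set (des (s powr (-1/2) * m) ! (i - 1))" for a I
      using des i that unfolding scaling_family_def by blast
    have d: "form_eq A 2 (ext_d (?x i)) (form_lincomb e (s powr r i \<cdot>\<^sub>t (des m ! (i - 1))))"
    proof -
      have "form_eq A 1 (?x i) (form_lincomb e [(s powr r i, [i])])" by (simp add: form_eq_def)
      from e.ext_d_form_eq [OF this] i
      have "form_eq A 2 (ext_d (?x i)) (form_lincomb e (d_terms (\<lambda>i. des m ! (i - 1)) [(s powr r i, [i])]))"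
        by (simp add: numeral_2_eq_2)
      then show ?thesis
        by (simp add: d_terms_def wedge_terms_def split_def)
    qed
    have "lincomb (\<lambda>i. ?x i c p) (s powr (-1/2) \<cdot>\<^sub>t (des m ! (i - 1))) vs
        = lincomb (\<lambda>i. e i c p) (s powr r i \<cdot>\<^sub>t (des m ! (i - 1))) vs" for c p vs
    proof -
      have "map (\<lambda>(a, I). (a * prod_list (map (\<lambda>i. s powr r i) I), I)) (des m ! (i - 1))
          = s powr (r i + 1/2) \<cdot>\<^sub>t (des m ! (i - 1))"
        unfolding scale_terms_def
        using des i by (intro map_cong refl)
          (auto simp: prod_list_powr [OF \<open>0 < s\<close>] scaling_family_def simp del: One_nat_def)
      moreover have "s powr (-1/2) * s powr (r i + 1/2) = s powr r i"
        by (simp add: powr_add [symmetric])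
      ultimately have "s powr (-1/2) * lincomb (\<lambda>i. ?x i c p) (des m ! (i - 1)) vs
          = lincomb (\<lambda>i. e i c p) (s powr r i \<cdot>\<^sub>t (des m ! (i - 1))) vs"
        unfolding lincomb_scaled_coframe by (simp only: lincomb_scale mult.assoc [symmetric])
      then show ?thesis by (simp only: lincomb_scale)
    qed
    moreover have "des (s powr (-1/2) * m) ! (i - 1) = s powr (-1/2) \<cdot>\<^sub>t (des m ! (i - 1))"
      using des i unfolding scaling_family_def by blast
    ultimately show "form_eq A 2 (ext_d (?x i)) (form_lincomb ?x (des (s powr (-1/2) * m) ! (i - 1)))"
      using d by (simp add: form_eq_def form_lincomb_def)
  next
    fix c p assume cp: "c \<in> A" "p \<in> fst c"
    note cof = e.coframe [OF cp]
    show "is_coframe (\<lambda>i. ?x i c p)"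
      unfolding is_coframe_def
    proof (intro conjI ballI allI impI)
      fix i :: nat assume i: "i \<in> {1..7}"
      show "is_covector 1 (?x i c p)"
        unfolding form_lincomb_def
        by (rule is_covector_lincomb) (use cof i in \<open>auto simp: is_coframe_def\<close>)
    next
      fix a :: "nat \<Rightarrow> real" and i :: nat
      assume a: "\<forall>v. (\<Sum>i\<in>{1..7}. a i * ?x i c p [v]) = 0" and i: "i \<in> {1..7}"
      have "?x i c p [v] = s powr r i * e i c p [v]" for i v
        by (simp add: form_lincomb_def lincomb_Cons cov_mono_Cons wedge1_Cons unit_covector_def)
      with a have "\<forall>v. (\<Sum>i\<in>{1..7}. (a i * s powr r i) * e i c p [v]) = 0"
        by (simp add: mult.assoc)
      then have "a i * s powr r i = 0"
        using cof i unfolding is_coframe_def by (elim conjE allE [of _ "\<lambda>i. a i * s powr r i"]) blast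
      then show "a i = 0" using \<open>0 < s\<close> by simp
    qed
  qed
qed

lemma lincomb_powr_derivative:
  assumes "0 < 1 + k * t"
  shows "((\<lambda>s. lincomb y (map (\<lambda>(a, I). (a * (1 + k * s) powr q I, I)) ts) vs) has_real_derivative
    lincomb y (map (\<lambda>(a, I). (a * (q I * k * (1 + k * t) powr (q I - 1)), I)) ts) vs) (at t)"
proof (induction ts)
  case (Cons u ts)
  obtain a I where u: "u = (a, I)" by force
  have "((\<lambda>s. (1 + k * s) powr q I) has_real_derivative q I * k * (1 + k * t) powr (q I - 1)) (at t)"
    using assms by (auto intro!: derivative_eq_intros simp: powr_diff field_simps)
  then show ?case
    using Cons unfolding u by (auto simp: lincomb_Cons intro!: DERIV_add DERIV_cmult DERIV_cmult_right)
qed simp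

text \<open>With q the weight sum of I and N = 1 + \<kappa> m^2 t, the coefficient N^q has
  derivative q \<kappa> m^2 N^(q - 1), while minus the Laplacian multiplies it by \<kappa> q \<mu>^2
  = \<kappa> q m^2 / N. Both sides carry the same power of N, so one identity, required for all
  values of the parameter, serves for every t.\<close>

lemma invariant_coflow_power_family:
  fixes m \<kappa> :: real and J :: "real set"
  assumes G: "lie_group G T A" and e: "has_structure_equations G T A e (des m)"
    and J: "open J" "\<And>t. t \<in> J \<Longrightarrow> 0 < 1 + \<kappa> * m\<^sup>2 * t"
    and \<phi>: "\<And>t c p vs. t \<in> J \<Longrightarrow> \<phi> t c p vs = lincomb (\<lambda>i. e i c p)
      (map (\<lambda>(a, I). (a * (1 + \<kappa> * m\<^sup>2 * t) powr sum_list (map r I), I)) g2_terms) vs"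
    and des: "scaling_family des r"
    and lcp: "\<And>\<mu>. lcp_equations (\<lambda>i. des \<mu> ! (i - 1)) \<mu> (\<lambda>I. \<kappa> * sum_list (map r I))"
  shows "invariant_coflow G T A J \<phi>"
proof -
  define N where "N = (\<lambda>t. 1 + \<kappa> * m\<^sup>2 * t)"
  define x where "x = (\<lambda>t i. form_lincomb e [(N t powr r i, [i])])"
  define \<mu> where "\<mu> = (\<lambda>t. N t powr (-1/2) * m)"
  let ?q = "\<lambda>I. sum_list (map r I)"
  have N: "0 < N t" if "t \<in> J" for t using J(2) [OF that] by (simp add: N_def)
  have atlas: "smooth_atlas T A" using G by (simp add: lie_group_def smooth_manifold_def)
  have frame: "invariant_coframe G T A (x t) (\<lambda>i. des (\<mu> t) ! (i - 1))" if "t \<in> J" for t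
    unfolding x_def \<mu>_def
    by (rule invariant_coframe_scaled
        [OF invariant_coframe_structure_equations [OF atlas e des] des N [OF that]])
  have x: "lincomb (\<lambda>i. x t i c p) ts vs
      = lincomb (\<lambda>i. e i c p) (map (\<lambda>(a, I). (a * N t powr ?q I, I)) ts) vs" if "t \<in> J" for t c p ts vs
    unfolding x_def lincomb_scaled_coframe prod_list_powr [OF N [OF that]] ..
  \<comment> \<open>An equality of functions, so that it may be substituted inside the star, the
    Laplacian and \<open>lcp\<close>.\<close>
  have \<phi>x: "\<phi> t = form_lincomb (x t) g2_terms" if "t \<in> J" for t
    using \<phi> [OF that] x [OF that] by (simp add: form_lincomb_def fun_eq_iff N_def)
  have star_\<phi>: "star (\<phi> t) 3 (\<phi> t) c p vs = lincomb (\<lambda>i. e i c p)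
      (map (\<lambda>(a, I). (a * N t powr ?q I, I)) psi_terms) vs"
    if "t \<in> J" "c \<in> A" "p \<in> fst c" for t c p vs
  proof -
    interpret invariant_coframe G T A "x t" "\<lambda>i. des (\<mu> t) ! (i - 1)" by (rule frame [OF that(1)])
    show ?thesis
      using star_phi [of "length vs"] that(2,3)
      by (simp add: \<phi>x [OF that(1)] form_eq_def form_lincomb_def x [OF that(1)])
  qed
  have deriv: "((\<lambda>s. star (\<phi> s) 3 (\<phi> s) c p vs) has_real_derivative
      - laplacian (\<phi> t) 4 (star (\<phi> t) 3 (\<phi> t)) c p vs) (at t)"
    if t: "t \<in> J" and cp: "c \<in> A" "p \<in> fst c" and vs: "length vs = 4" for t c p vs
  proof -
    interpret invariant_coframe G T A "x t" "\<lambda>i. des (\<mu> t) ! (i - 1)" by (rule frame [OF t])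
    have \<mu>2: "(\<mu> t)\<^sup>2 = m\<^sup>2 / N t"
      using N [OF t] by (simp add: \<mu>_def power_mult_distrib power2_eq_square [of "_ powr _"]
          powr_add [symmetric] powr_minus divide_simps)
    have "- laplacian (\<phi> t) 4 (star (\<phi> t) 3 (\<phi> t)) c p vs
        = - lincomb (\<lambda>i. x t i c p) (map (\<lambda>(a, I). (- (\<kappa> * ?q I * (\<mu> t)\<^sup>2 * a), I)) psi_terms) vs"
      using laplacian_star_phi [OF lcp] cp vs
      by (simp add: \<phi>x [OF t] form_eq_def form_lincomb_def)
    also have "\<dots> = lincomb (\<lambda>i. x t i c p) (-1 \<cdot>\<^sub>t map (\<lambda>(a, I). (- (\<kappa> * ?q I * (\<mu> t)\<^sup>2 * a), I)) psi_terms) vs"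
      by (simp only: lincomb_scale)
    also have "\<dots> = lincomb (\<lambda>i. e i c p)
        (map (\<lambda>(a, I). (a * (?q I * (\<kappa> * m\<^sup>2) * N t powr (?q I - 1)), I)) psi_terms) vs"
      unfolding x [OF t] \<mu>2 scale_terms_def map_map
      using N [OF t]
      by (intro arg_cong [of _ _ "\<lambda>ts. lincomb _ ts _"] map_cong refl)
        (auto simp: powr_diff)
    finally have lap: "- laplacian (\<phi> t) 4 (star (\<phi> t) 3 (\<phi> t)) c p vs = \<dots>" .
    have "((\<lambda>s. lincomb (\<lambda>i. e i c p) (map (\<lambda>(a, I). (a * N s powr ?q I, I)) psi_terms) vs)
        has_real_derivative - laplacian (\<phi> t) 4 (star (\<phi> t) 3 (\<phi> t)) c p vs) (at t)"
      unfolding lap N_def by (rule lincomb_powr_derivative) (use J(2) [OF t] in simp)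
    then show ?thesis
      \<comment> \<open>The formula for psi is known for times in \<open>J\<close> only; openness of
        \<open>J\<close> lets the derivative at \<open>t\<close> pass to psi itself.\<close>
      by (rule has_field_derivative_transform_within_open [OF _ J(1) t]) (simp add: star_\<phi> cp)
  qed
  show ?thesis
    unfolding invariant_coflow_def laplacian_lcp_coflow_def Let_def
  proof (intro conjI ballI allI impI)
    fix t assume t: "t \<in> J"
    interpret invariant_coframe G T A "x t" "\<lambda>i. des (\<mu> t) ! (i - 1)" by (rule frame [OF t])
    show "g2_structure T A (\<phi> t)" "left_invariant G A 3 (\<phi> t)" "lcp T A (\<phi> t)"
      "form_eq A 3 (star (\<phi> t) 4 (star (\<phi> t) 3 (\<phi> t))) (\<phi> t)"
      unfolding \<phi>x [OF t]
      by (rule g2_structure_phi left_invariant_phi lcp_phi [OF lcp] star_star_phi)+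
  qed (rule deriv)
qed

section \<open>The seven Lie algebras\<close>

text \<open>After sorting, each equation becomes a polynomial identity in \<open>\<mu>\<close> with
  monomials as atoms, which the simplifier decides for explicit structure equations.\<close>

lemma lcp_equationsI:
  assumes "\<And>y vs. lincomb y (sort_terms (d_terms D g2_terms)) vs
      = lincomb y (sort_terms ((3 * \<mu>) \<cdot>\<^sub>t wedge_terms [(1, [7])] g2_terms)) vs"
    and "\<And>y vs. lincomb y (sort_terms (d_terms D psi_terms)) vs
      = lincomb y (sort_terms ((4 * \<mu>) \<cdot>\<^sub>t wedge_terms [(1, [7])] psi_terms)) vs"
    and "\<And>y vs. lincomb y (sort_terms
        ((3 * \<mu>) \<cdot>\<^sub>t d_terms D im_terms @ (- 4 * \<mu>) \<cdot>\<^sub>t star_terms (d_terms D omega_terms))) vs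
      = lincomb y (sort_terms (map (\<lambda>(a, I). (- (L I * \<mu>\<^sup>2 * a), I)) psi_terms)) vs"
  shows "lcp_equations D \<mu> L"
  using assms unfolding lcp_equations_def lincomb_sort by blast

definition weight :: "real list \<Rightarrow> nat \<Rightarrow> real" where
  "weight ws i = ws ! (i - 1)"

lemma atLeastAtMost_1_7: "{1..7::nat} = {1, 2, 3, 4, 5, 6, 7}"
  by auto

text \<open>The monomials of psi without index 7 need the eigenvalue factor 8, those with index 7
  the factor 9. The constant 6 yields both, as 6 times 4/3 and 6 times 3/2.\<close>

lemma lcp_equations_cp1:
  "lcp_equations (\<lambda>i. cp1 \<mu> ! (i - 1)) \<mu>
    (\<lambda>I. 6 * sum_list (map (weight [1/3, 1/3, 1/3, 1/3, 1/3, 1/3, 1/2]) I))"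
  by (rule lcp_equationsI; simp add: terms_eval cp1_def weight_def lincomb_Cons power2_eq_square;
      simp add: algebra_simps)

text \<open>Terms e^(i7) in d e^i only ask that the last weight be 1/2.\<close>

lemma scaling_family_cp1: "scaling_family cp1 (weight [1/3, 1/3, 1/3, 1/3, 1/3, 1/3, 1/2])"
  unfolding scaling_family_def atLeastAtMost_1_7
  by (auto simp: cp1_def weight_def scale_terms_def)

lemma lcp_equations_cp2:
  "lcp_equations (\<lambda>i. cp2 \<mu> ! (i - 1)) \<mu>
    (\<lambda>I. 16/3 * sum_list (map (weight [1/4, 5/16, 3/8, 5/16, 5/16, 3/8, 1/2]) I))"
  by (rule lcp_equationsI; simp add: terms_eval cp2_def weight_def lincomb_Cons power2_eq_square;
      simp add: algebra_simps)

text \<open>The term e^36 in d e^1 adds the condition r 3 + r 6 = r 1 + 1/2, met by 3/8 + 3/8 = 1/4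
  + 1/2. The quadratic terms of the later algebras constrain their weights in the same way.\<close>

lemma scaling_family_cp2: "scaling_family cp2 (weight [1/4, 5/16, 3/8, 5/16, 5/16, 3/8, 1/2])"
  unfolding scaling_family_def atLeastAtMost_1_7
  by (auto simp: cp2_def weight_def scale_terms_def)

lemma lcp_equations_cp3:
  "lcp_equations (\<lambda>i. cp3 \<mu> ! (i - 1)) \<mu>
    (\<lambda>I. 5 * sum_list (map (weight [1/5, 3/10, 7/20, 7/20, 7/20, 7/20, 1/2]) I))"
  by (rule lcp_equationsI; simp add: terms_eval cp3_def weight_def lincomb_Cons power2_eq_square;
      simp add: algebra_simps)

lemma scaling_family_cp3: "scaling_family cp3 (weight [1/5, 3/10, 7/20, 7/20, 7/20, 7/20, 1/2])"
  unfolding scaling_family_def atLeastAtMost_1_7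
  by (auto simp: cp3_def weight_def scale_terms_def)

lemma lcp_equations_cp4:
  "lcp_equations (\<lambda>i. cp4 \<mu> ! (i - 1)) \<mu>
    (\<lambda>I. 24/5 * sum_list (map (weight [5/24, 1/4, 1/3, 3/8, 1/3, 3/8, 1/2]) I))"
  by (rule lcp_equationsI; simp add: terms_eval cp4_def weight_def lincomb_Cons power2_eq_square;
      simp add: algebra_simps)

lemma scaling_family_cp4: "scaling_family cp4 (weight [5/24, 1/4, 1/3, 3/8, 1/3, 3/8, 1/2])"
  unfolding scaling_family_def atLeastAtMost_1_7
  by (auto simp: cp4_def weight_def scale_terms_def)

lemma lcp_equations_cp5:
  "lcp_equations (\<lambda>i. cp5 \<mu> ! (i - 1)) \<mu>
    (\<lambda>I. 5 * sum_list (map (weight [1/4, 1/4, 3/10, 2/5, 7/20, 7/20, 1/2]) I))"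
  by (rule lcp_equationsI; simp add: terms_eval cp5_def weight_def lincomb_Cons power2_eq_square;
      simp add: algebra_simps)

lemma scaling_family_cp5: "scaling_family cp5 (weight [1/4, 1/4, 3/10, 2/5, 7/20, 7/20, 1/2])"
  unfolding scaling_family_def atLeastAtMost_1_7
  by (auto simp: cp5_def weight_def scale_terms_def)

lemma lcp_equations_cp6:
  "lcp_equations (\<lambda>i. cp6 \<mu> ! (i - 1)) \<mu>
    (\<lambda>I. 14/3 * sum_list (map (weight [3/14, 3/14, 5/14, 5/14, 5/14, 5/14, 1/2]) I))"
  by (rule lcp_equationsI; simp add: terms_eval cp6_def weight_def lincomb_Cons power2_eq_square;
      simp add: algebra_simps)

lemma scaling_family_cp6: "scaling_family cp6 (weight [3/14, 3/14, 5/14, 5/14, 5/14, 5/14, 1/2])"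
  unfolding scaling_family_def atLeastAtMost_1_7
  by (auto simp: cp6_def weight_def scale_terms_def)

lemma lcp_equations_cp7:
  "lcp_equations (\<lambda>i. cp7 \<mu> ! (i - 1)) \<mu>
    (\<lambda>I. 24/5 * sum_list (map (weight [1/4, 3/8, 3/8, 1/4, 1/4, 3/8, 1/2]) I))"
  by (rule lcp_equationsI; simp add: terms_eval cp7_def weight_def lincomb_Cons power2_eq_square;
      simp add: algebra_simps)

lemma scaling_family_cp7: "scaling_family cp7 (weight [1/4, 3/8, 3/8, 1/4, 1/4, 3/8, 1/2])"
  unfolding scaling_family_def atLeastAtMost_1_7
  by (auto simp: cp7_def weight_def scale_terms_def)

theorem corollary4p2:
  fixes m :: real
    and G :: "'g monoid" and T :: "'g topology" and A :: "('g, real ^ 7) chart set"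
    and e :: "nat \<Rightarrow> 'g form"
  assumes "m \<noteq> 0"
    and "lie_group G T A"
    and "solvable G"
  shows
    "(has_structure_equations G T A e (cp1 m) \<longrightarrow>
        invariant_coflow G T A {- (1 / (6 * m\<^sup>2)) <..} (\<lambda>t. form_lincomb e
          ((1 + 6 * m\<^sup>2 * t) powr (7/6) \<cdot>\<^sub>t [(1, [1,2,7]), (1, [3,4,7]), (1, [5,6,7])] @
           (1 + 6 * m\<^sup>2 * t) \<cdot>\<^sub>t [(1, [1,3,5]), (-1, [1,4,6]), (-1, [2,3,6]), (-1, [2,4,5])]))) \<and>
     (has_structure_equations G T A e (cp2 m) \<longrightarrow>
        invariant_coflow G T A {- (3 / (16 * m\<^sup>2)) <..} (\<lambda>t. form_lincomb e
          ((1 + 16/3 * m\<^sup>2 * t) powr (17/16) \<cdot>\<^sub>t [(1, [1,2,7]), (-1, [2,3,6])] @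
           (1 + 16/3 * m\<^sup>2 * t) powr (19/16) \<cdot>\<^sub>t [(1, [3,4,7]), (1, [5,6,7])] @
           (1 + 16/3 * m\<^sup>2 * t) powr (15/16) \<cdot>\<^sub>t [(1, [1,3,5]), (-1, [1,4,6]), (-1, [2,4,5])]))) \<and>
     (has_structure_equations G T A e (cp3 m) \<longrightarrow>
        invariant_coflow G T A {- (1 / (5 * m\<^sup>2)) <..} (\<lambda>t. form_lincomb e
          ((1 + 5 * m\<^sup>2 * t) \<cdot>\<^sub>t [(1, [1,2,7]), (-1, [2,3,6]), (-1, [2,4,5])] @
           (1 + 5 * m\<^sup>2 * t) powr (6/5) \<cdot>\<^sub>t [(1, [3,4,7]), (1, [5,6,7])] @
           (1 + 5 * m\<^sup>2 * t) powr (9/10) \<cdot>\<^sub>t [(1, [1,3,5]), (-1, [1,4,6])]))) \<and>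
     (has_structure_equations G T A e (cp4 m) \<longrightarrow>
        invariant_coflow G T A {- (5 / (24 * m\<^sup>2)) <..} (\<lambda>t. form_lincomb e
          ((1 + 24/5 * m\<^sup>2 * t) powr (23/24) \<cdot>\<^sub>t
              [(1, [1,2,7]), (-1, [1,4,6]), (-1, [2,3,6]), (-1, [2,4,5])] @
           (1 + 24/5 * m\<^sup>2 * t) powr (29/24) \<cdot>\<^sub>t [(1, [3,4,7]), (1, [5,6,7])] @
           (1 + 24/5 * m\<^sup>2 * t) powr (7/8) \<cdot>\<^sub>t [(1, [1,3,5])]))) \<and>
     (has_structure_equations G T A e (cp5 m) \<longrightarrow>
        invariant_coflow G T A {- (1 / (5 * m\<^sup>2)) <..} (\<lambda>t. form_lincomb e
          ((1 + 5 * m\<^sup>2 * t) \<cdot>\<^sub>t [(1, [1,2,7]), (-1, [1,4,6]), (-1, [2,4,5])] @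
           (1 + 5 * m\<^sup>2 * t) powr (6/5) \<cdot>\<^sub>t [(1, [3,4,7]), (1, [5,6,7])] @
           (1 + 5 * m\<^sup>2 * t) powr (9/10) \<cdot>\<^sub>t [(1, [1,3,5]), (-1, [2,3,6])]))) \<and>
     (has_structure_equations G T A e (cp6 m) \<longrightarrow>
        invariant_coflow G T A {- (3 / (14 * m\<^sup>2)) <..} (\<lambda>t. form_lincomb e
          ((1 + 14/3 * m\<^sup>2 * t) powr (13/14) \<cdot>\<^sub>t
              [(1, [1,2,7]), (1, [1,3,5]), (-1, [1,4,6]), (-1, [2,3,6]), (-1, [2,4,5])] @
           (1 + 14/3 * m\<^sup>2 * t) powr (17/14) \<cdot>\<^sub>t [(1, [3,4,7]), (1, [5,6,7])]))) \<and>
     (has_structure_equations G T A e (cp7 m) \<longrightarrow>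
        invariant_coflow G T A {- (5 / (24 * m\<^sup>2)) <..} (\<lambda>t. form_lincomb e
          ((1 + 24/5 * m\<^sup>2 * t) powr (9/8) \<cdot>\<^sub>t
              [(1, [1,2,7]), (1, [3,4,7]), (1, [5,6,7]), (-1, [2,3,6])] @
           (1 + 24/5 * m\<^sup>2 * t) powr (7/8) \<cdot>\<^sub>t [(1, [1,3,5]), (-1, [1,4,6]), (-1, [2,4,5])])))"
proof -
  have m: "0 < m\<^sup>2" using assms(1) by simp
  note family = invariant_coflow_power_family [OF assms(2) _ open_greaterThan]
  note expand = form_lincomb_def lincomb_Cons scale_terms_def g2_terms_def weight_def
  show ?thesis
  proof (intro conjI impI, goal_cases)
    case 1
    \<comment> \<open>The left end of the interval is the zero of this affine function of t.\<close>
    have pos: "0 < 1 + 6 * m\<^sup>2 * t" if "t \<in> {- (1 / (6 * m\<^sup>2)) <..}" for t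
      using that m by (simp add: field_simps)
    show ?case
      \<comment> \<open>Some weight sums are 1; positivity of the base then identifies its power
        \<open>powr 1\<close> with the base itself, the form in which the coefficient is
        given.\<close>
      by (rule family [OF 1 _ _ scaling_family_cp1 lcp_equations_cp1],
          erule pos, drule pos, simp add: expand)
  next
    case 2
    have pos: "0 < 1 + 16/3 * m\<^sup>2 * t" if "t \<in> {- (3 / (16 * m\<^sup>2)) <..}" for t
      using that m by (simp add: field_simps)
    show ?case
      by (rule family [OF 2 _ _ scaling_family_cp2 lcp_equations_cp2],
          erule pos, drule pos, simp add: expand)
  next
    case 3
    have pos: "0 < 1 + 5 * m\<^sup>2 * t" if "t \<in> {- (1 / (5 * m\<^sup>2)) <..}" for t
      using that m by (simp add: field_simps)
    show ?case
      by (rule family [OF 3 _ _ scaling_family_cp3 lcp_equations_cp3],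
          erule pos, drule pos, simp add: expand)
  next
    case 4
    have pos: "0 < 1 + 24/5 * m\<^sup>2 * t" if "t \<in> {- (5 / (24 * m\<^sup>2)) <..}" for t
      using that m by (simp add: field_simps)
    show ?case
      by (rule family [OF 4 _ _ scaling_family_cp4 lcp_equations_cp4],
          erule pos, drule pos, simp add: expand)
  next
    case 5
    have pos: "0 < 1 + 5 * m\<^sup>2 * t" if "t \<in> {- (1 / (5 * m\<^sup>2)) <..}" for t
      using that m by (simp add: field_simps)
    show ?case
      by (rule family [OF 5 _ _ scaling_family_cp5 lcp_equations_cp5],
          erule pos, drule pos, simp add: expand)
  next
    case 6
    have pos: "0 < 1 + 14/3 * m\<^sup>2 * t" if "t \<in> {- (3 / (14 * m\<^sup>2)) <..}" for t
      using that m by (simp add: field_simps)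
    show ?case
      by (rule family [OF 6 _ _ scaling_family_cp6 lcp_equations_cp6],
          erule pos, drule pos, simp add: expand)
  next
    case 7
    have pos: "0 < 1 + 24/5 * m\<^sup>2 * t" if "t \<in> {- (5 / (24 * m\<^sup>2)) <..}" for t
      using that m by (simp add: field_simps)
    show ?case
      by (rule family [OF 7 _ _ scaling_family_cp7 lcp_equations_cp7],
          erule pos, drule pos, simp add: expand)
  qed
qed

end
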